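(* Let $N\ge 3$ be an integer and $r\in[1,+\infty)$. Let $\mu$ be an atomless probability measure on $\mathbb{R}$ with $\mathrm{conv}(\mathrm{supp}(\mu))=[a,b]$, where $-\infty<a<b<+\infty$. Then the $L^r$-optimal dual quantization grids of $\mu$ at level $N$ are of the form $\{a,x_2,\ldots,x_{N-1},b\}$ with $(x_2,\ldots,x_{N-1})\in\mathcal{S}^{a,b}_N$ solving $\nabla L_N(x_2,\ldots,x_{N-1})=0$. If, moreover, $\mu$ admits a density $f$ with respect to the Lebesgue measure which is positive and $\log$-concave on $(a,b)$ and vanishes outside $(a,b)$, then the unique $L^r$-optimal dual quantization grid of $\mu$ at level $N$ is $\{a,x^\star_2,\ldots,x^\star_{N-1},b\}$, where $x^\star=(x_2^\star,\ldots,x_{N-1}^\star)$ is the unique critical point of $L_N$ in $\mathcal{S}^{a,b}_N$.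
   Context: A dual quantization grid for $\mu$ at level $N$ is a finite set $\Gamma=\{x_1<x_2<\cdots<x_M\}\subset\mathbb{R}$ with $M\le N$ and $\mathrm{conv}(\Gamma)\supset\mathrm{supp}(\mu)$, i.e. $x_1\le a$ and $x_M\ge b$. Its $L^r$ dual quantization error raised to the power $r$ is $$\sum_{i=1}^{M-1}\int_{[x_i,x_{i+1})}\Big((\xi-x_i)^r\frac{x_{i+1}-\xi}{x_{i+1}-x_i}+(x_{i+1}-\xi)^r\frac{\xi-x_i}{x_{i+1}-x_i}\Big)\mu(d\xi)$$ (the integrands vanish at the grid points). Equivalently it is $\mathbb{E}|X-\widehat X|^r$, where $X\sim\mu$ and, given $X\in[x_i,x_{i+1}]$, $\widehat X$ equals $x_i$ with probability $\frac{x_{i+1}-X}{x_{i+1}-x_i}$ and $x_{i+1}$ with probability $\frac{X-x_i}{x_{i+1}-x_i}$. The grid $\Gamma$ is $L^r$-optimal at level $N$ if it minimizes this error among all dual quantization grids at level $N$. $\mathcal{S}^{a,b}_N=\{(x_2,\ldots,x_{N-1})\in(a,b)^{N-2}: x_2<\cdots<x_{N-1}\}$. For $x\in\mathcal{S}^{a,b}_N$, with the convention $x_1=a$, $x_N=b$, $L_N(x)$ denotes the $L^r$ dual quantization error raised to the power $r$ of the grid $\{a,x_2,\ldots,x_{N-1},b\}$: $$L_N(x)=\sum_{i=1}^{N-1}\int_{(x_i,x_{i+1})}\Big((\xi-x_i)^r\frac{x_{i+1}-\xi}{x_{i+1}-x_i}+(x_{i+1}-\xi)^r\frac{\xi-x_i}{x_{i+1}-x_i}\Big)\mu(d\xi).$$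 A critical point of $L_N$ is a point of $\mathcal{S}^{a,b}_N$ where $\nabla L_N=0$. *)

theory Defs
  imports "HOL-Probability.Probability"
begin

definition measure_support :: "real measure \<Rightarrow> real set" where
  "measure_support \<mu> = {x. \<forall>U. open U \<longrightarrow> x \<in> U \<longrightarrow> emeasure \<mu> U > 0}"

definition cell_cost :: "real \<Rightarrow> real \<Rightarrow> real \<Rightarrow> real \<Rightarrow> real" where
  "cell_cost r u v \<xi> =
     (\<xi> - u) powr r * ((v - \<xi>) / (v - u)) + (v - \<xi>) powr r * ((\<xi> - u) / (v - u))"

definition dual_grid :: "real measure \<Rightarrow> nat \<Rightarrow> real set \<Rightarrow> bool" where
  "dual_grid \<mu> N \<Gamma> \<longleftrightarrow>
     finite \<Gamma> \<and> card \<Gamma> \<le> N \<and> measure_support \<mu> \<subseteq> convex hull \<Gamma>"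

text \<open>The \<open>r\<close>-th power of the \<open>L\<^sup>r\<close> error; list positions start at \<open>0\<close>, so the
  grid point \<open>x\<^sub>i\<close> is \<open>xs ! (i - 1)\<close>.\<close>

definition dual_error :: "real \<Rightarrow> real measure \<Rightarrow> real set \<Rightarrow> real" where
  "dual_error r \<mu> \<Gamma> =
     (let xs = sorted_list_of_set \<Gamma> in
      \<Sum>i<length xs - 1. LINT \<xi>:{xs ! i..<xs ! Suc i}|\<mu>. cell_cost r (xs ! i) (xs ! Suc i) \<xi>)"

definition optimal_dual_grid :: "real \<Rightarrow> real measure \<Rightarrow> nat \<Rightarrow> real set \<Rightarrow> bool" where
  "optimal_dual_grid r \<mu> N \<Gamma> \<longleftrightarrow>
     dual_grid \<mu> N \<Gamma> \<and> (\<forall>\<Gamma>'. dual_grid \<mu> N \<Gamma>' \<longrightarrow> dual_error r \<mu> \<Gamma> \<le> dual_error r \<mu> \<Gamma>')"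

text \<open>The free points \<open>(x\<^sub>2, \<dots>, x\<^bsub>N-1\<^esub>)\<close> form a vector in \<open>real ^ 'n\<close> with
  \<open>CARD('n) = N - 2\<close>. The index type is linearly ordered and its elements, in increasing
  order, play the role of the indices \<open>2, \<dots>, N - 1\<close>.\<close>

definition ordered_simplex :: "real \<Rightarrow> real \<Rightarrow> (real ^ 'n::{finite,linorder}) set" where
  "ordered_simplex a b = {x. (\<forall>i. x $ i \<in> {a<..<b}) \<and> strict_mono (\<lambda>i. x $ i)}"

text \<open>The list \<open>[x\<^sub>1, \<dots>, x\<^sub>N]\<close> with \<open>x\<^sub>1 = a\<close> and \<open>x\<^sub>N = b\<close>.\<close>

definition nodes :: "real \<Rightarrow> real \<Rightarrow> real ^ 'n::{finite,linorder} \<Rightarrow> real list" where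
  "nodes a b x = a # map (\<lambda>i. x $ i) (sorted_list_of_set UNIV) @ [b]"

definition dual_distortion ::
    "real \<Rightarrow> real measure \<Rightarrow> real \<Rightarrow> real \<Rightarrow> real ^ 'n::{finite,linorder} \<Rightarrow> real" where
  "dual_distortion r \<mu> a b x =
     (let xs = nodes a b x in
      \<Sum>i<length xs - 1. LINT \<xi>:{xs ! i<..<xs ! Suc i}|\<mu>. cell_cost r (xs ! i) (xs ! Suc i) \<xi>)"

text \<open>The domain is open in \<open>real ^ 'n\<close>, so the values of \<^const>\<open>dual_distortion\<close> at
  unordered vectors do not affect the gradient.\<close>

definition critical_point ::
    "real \<Rightarrow> real measure \<Rightarrow> real \<Rightarrow> real \<Rightarrow> real ^ 'n::{finite,linorder} \<Rightarrow> bool" where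
  "critical_point r \<mu> a b x \<longleftrightarrow>
     x \<in> ordered_simplex a b \<and> (GDERIV (dual_distortion r \<mu> a b) x :> 0)"

end

theory Submission
  imports Defs
begin

text \<open>With \<open>s = \<xi> - u\<close> and \<open>t = v - \<xi>\<close> the cost of a cell \<open>(u, v)\<close> is
  \<open>(s\<^sup>r t + t\<^sup>r s) / (s + t)\<close>, strictly increasing in \<open>s\<close> and \<open>t\<close>; hence refining a grid lowers
  its error, which forces an optimal grid to contain \<open>a\<close> and \<open>b\<close>, to stay in \<open>[a, b]\<close> and to use
  all \<open>N\<close> points. The cost extended by \<open>0\<close> is Lipschitz and differentiable for almost every \<open>\<xi>\<close>,
  so the error is differentiable by dominated convergence. Optimal grids are therefore critical
  points, and they exist because the error is continuous on the compact set of weakly increasing vectors.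

  Criticality of \<open>x\<close> says \<open>R(x\<^bsub>j-1\<^esub>, x\<^sub>j) = L(x\<^sub>j, x\<^bsub>j+1\<^esub>)\<close>, where \<open>R = \<partial>\<^sub>v\<close> and \<open>L = - \<partial>\<^sub>u\<close> of the
  error of the cell \<open>(u, v)\<close> are positive, \<open>R\<close> decreases in \<open>u\<close> and \<open>L\<close> increases strictly in \<open>v\<close>. If
  \<open>x\<close> and \<open>y\<close> are critical and \<open>\<delta> = y\<^sub>j - x\<^sub>j > 0\<close> is the largest difference of their coordinates, at
  the last such \<open>j\<close>, log-concavity gives for \<open>c = f (x\<^sub>j + \<delta>) / f x\<^sub>j\<close> the contradiction
  \<open>c R(x\<^bsub>j-1\<^esub>, x\<^sub>j) \<le> R(x\<^bsub>j-1\<^esub> + \<delta>, x\<^sub>j + \<delta>) \<le> R(y\<^bsub>j-1\<^esub>, y\<^sub>j) = L(y\<^sub>j, y\<^bsub>j+1\<^esub>) <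
  L(x\<^sub>j + \<delta>, x\<^bsub>j+1\<^esub> + \<delta>) \<le> c L(x\<^sub>j, x\<^bsub>j+1\<^esub>)\<close>.\<close>

section \<open>Cost of a cell as a function of the distances to its two ends\<close>

text \<open>The extension by 0 lets every cell be integrated over the whole line, with a domain of
  integration that does not move with the nodes. Degenerate cells cost nothing.\<close>

definition gap_cost :: "real \<Rightarrow> real \<Rightarrow> real \<Rightarrow> real" where
  "gap_cost r s t = (if s > 0 \<and> t > 0 then (s powr r * t + t powr r * s) / (s + t) else 0)"

text \<open>The partial derivative of \<^term>\<open>gap_cost r s t\<close> in \<open>s\<close>, written through \<open>t / (s + t)\<close> so that
  each factor is visibly monotone in \<open>t\<close>.\<close>

definition gap_slope :: "real \<Rightarrow> real \<Rightarrow> real \<Rightarrow> real" where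
  "gap_slope r s t =
     (if s > 0 \<and> t > 0
      then s powr (r - 1) * (t / (s + t)) * (r - 1 + t / (s + t)) + t powr (r - 1) * (t / (s + t))\<^sup>2
      else 0)"

lemma gap_cost_commute: "gap_cost r s t = gap_cost r t s"
  by (auto simp: gap_cost_def add.commute)

lemma cell_cost_eq_gap_cost:
  assumes "u < \<xi>" "\<xi> < v"
  shows "cell_cost r u v \<xi> = gap_cost r (\<xi> - u) (v - \<xi>)"
  using assms by (simp add: cell_cost_def gap_cost_def add_divide_distrib)

text \<open>The axes are excluded because the extension by 0 has a kink along their positive halves.
  Off the axes the cost is either the smooth quotient or locally 0.\<close>

lemma gap_cost_has_derivative:
  assumes "s \<noteq> 0" "t \<noteq> 0"
  shows "((\<lambda>p. gap_cost r (fst p) (snd p)) has_derivative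
          (\<lambda>h. gap_slope r s t * fst h + gap_slope r t s * snd h)) (at (s, t))"
proof (cases "s > 0 \<and> t > 0")
  case True
  then have st: "s > 0" "t > 0" by auto
  \<comment> \<open>With the powers written as \<open>s * S\<close> and \<open>t * T\<close>, the
    quotient rule reduces to a rational identity in \<open>s\<close>, \<open>t\<close>,
    \<open>S\<close>, \<open>T\<close> and \<open>r\<close>.\<close>
  define S T where "S = s powr (r - 1)" and "T = t powr (r - 1)"
  have sr: "s powr r = s * S" "t powr r = t * T"
    using st by (simp_all add: powr_diff S_def T_def)
  have powr: "((\<lambda>z. z powr r) has_real_derivative r * z powr (r - 1)) (at z)" if "z > 0" for z
    using that by (rule has_real_derivative_powr)
  have ds: "((\<lambda>p. fst p powr r) has_derivative (\<lambda>h. r * S * fst h)) (at (s, t))"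
    using has_derivative_compose[OF has_derivative_fst[OF has_derivative_ident], of "\<lambda>z. z powr r" "(*) (r * S)" "(s, t)" UNIV]
      powr[OF st(1)] by (simp add: S_def has_field_derivative_def)
  have dt: "((\<lambda>p. snd p powr r) has_derivative (\<lambda>h. r * T * snd h)) (at (s, t))"
    using has_derivative_compose[OF has_derivative_snd[OF has_derivative_ident], of "\<lambda>z. z powr r" "(*) (r * T)" "(s, t)" UNIV]
      powr[OF st(2)] by (simp add: T_def has_field_derivative_def)
  note f = has_derivative_fst[OF has_derivative_ident] has_derivative_snd[OF has_derivative_ident]
  have "((\<lambda>p. (fst p powr r * snd p + snd p powr r * fst p) / (fst p + snd p)) has_derivative
          (\<lambda>h. gap_slope r s t * fst h + gap_slope r t s * snd h)) (at (s, t))"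
  proof (rule has_derivative_eq_rhs)
    show "((\<lambda>p. (fst p powr r * snd p + snd p powr r * fst p) / (fst p + snd p)) has_derivative
     (\<lambda>h. (((s * S * snd h + r * S * fst h * t) + (t * T * fst h + r * T * snd h * s)) * (s + t) -
           (s * S * t + t * T * s) * (fst h + snd h)) / ((s + t) * (s + t)))) (at (s, t))"
      using has_derivative_divide'[OF has_derivative_add[OF has_derivative_mult[OF ds f(2)] has_derivative_mult[OF dt f(1)]]
        has_derivative_add[OF f]] st by (simp add: sr)
    have e1: "((r * S * t + t * T) * (s + t) - (s * S * t + t * T * s)) / ((s + t) * (s + t)) = gap_slope r s t"
      using st by (simp add: gap_slope_def S_def[symmetric] T_def[symmetric] field_simps power2_eq_square,
          simp add: add_divide_distrib diff_divide_distrib)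
    have e2: "((r * T * s + s * S) * (s + t) - (s * S * t + t * T * s)) / ((s + t) * (s + t)) = gap_slope r t s"
      using st by (simp add: gap_slope_def S_def[symmetric] T_def[symmetric] field_simps power2_eq_square,
          simp add: add_divide_distrib diff_divide_distrib)
    show "(\<lambda>h. (((s * S * snd h + r * S * fst h * t) + (t * T * fst h + r * T * snd h * s)) * (s + t) -
           (s * S * t + t * T * s) * (fst h + snd h)) / ((s + t) * (s + t))) =
        (\<lambda>h. gap_slope r s t * fst h + gap_slope r t s * snd h)"
      unfolding e1[symmetric] e2[symmetric] times_divide_eq_left add_divide_distrib[symmetric]
      by (intro ext arg_cong2[where f = "(/)"]) (simp_all add: algebra_simps)
  qed
  moreover have "open ({0<..} \<times> {0<..} :: (real \<times> real) set)"
    by (intro open_Times) auto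
  ultimately show ?thesis
    by (rule has_derivative_transform_within_open) (use st in \<open>auto simp: gap_cost_def\<close>)
next
  case False
  \<comment> \<open>Both distances are nonzero and one is not positive, so the point lies in the
    open set where some distance is negative; there the cost is identically 0.\<close>
  have "open ((- {0..}) \<times> UNIV \<union> UNIV \<times> (- {0..}) :: (real \<times> real) set)"
    by (intro open_Times open_Un) auto
  then show ?thesis
    using False assms
    by (intro has_derivative_transform_within_open[OF has_derivative_const[of 0, THEN has_derivative_eq_rhs]])
      (auto simp: gap_cost_def gap_slope_def)
qed

lemma gap_slope_nonneg: "r \<ge> 1 \<Longrightarrow> gap_slope r s t \<ge> 0"
  by (simp add: gap_slope_def)

lemma gap_slope_pos: "\<lbrakk>r \<ge> 1; s > 0; t > 0\<rbrakk> \<Longrightarrow> gap_slope r s t > 0"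
  by (simp add: gap_slope_def add_nonneg_pos)

text \<open>The fraction \<open>t / (s + t)\<close> increases strictly in \<open>t\<close>. The
  first summand of the slope is therefore strictly increasing, also for \<open>r = 1\<close>, and
  the second is weakly increasing.\<close>

lemma gap_slope_strict_mono:
  assumes "r \<ge> 1" "s > 0" "t < t'" "t' > 0"
  shows "gap_slope r s t < gap_slope r s t'"
proof (cases "t > 0")
  case True
  define \<tau> \<tau>' where "\<tau> = t / (s + t)" and "\<tau>' = t' / (s + t')"
  have "\<tau> < \<tau>'" "\<tau> > 0"
    using assms True by (auto simp: \<tau>_def \<tau>'_def field_simps)
  then have "s powr (r - 1) * (\<tau> * (r - 1 + \<tau>)) < s powr (r - 1) * (\<tau>' * (r - 1 + \<tau>'))"
    using assms by (intro mult_strict_left_mono mult_strict_mono) auto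
  moreover have "t powr (r - 1) * \<tau>\<^sup>2 \<le> t' powr (r - 1) * \<tau>'\<^sup>2"
    using assms True \<open>\<tau> < \<tau>'\<close> \<open>\<tau> > 0\<close> by (intro mult_mono powr_mono2 power_mono) auto
  ultimately show ?thesis
    using assms True by (simp add: gap_slope_def \<tau>_def \<tau>'_def mult.assoc)
next
  case False
  then show ?thesis
    using gap_slope_pos[of r s t'] assms by (simp add: gap_slope_def)
qed

lemma gap_slope_mono:
  assumes "r \<ge> 1" "t \<le> t'"
  shows "gap_slope r s t \<le> gap_slope r s t'"
proof (cases "s > 0 \<and> t < t' \<and> t' > 0")
  case True
  then show ?thesis using gap_slope_strict_mono[of r s t t'] assms by auto
next
  case False
  then show ?thesis using assms by (auto simp: gap_slope_def)
qed

text \<open>Since \<open>t / (s + t)\<close> lies in [0, 1], the two summands are at most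
  \<open>r * W powr (r - 1)\<close> and \<open>W powr (r - 1)\<close>.\<close>

lemma gap_slope_le:
  assumes "r \<ge> 1" "s \<le> W" "t \<le> W"
  shows "gap_slope r s t \<le> (r + 1) * W powr (r - 1)"
proof (cases "s > 0 \<and> t > 0")
  case True
  define \<tau> where "\<tau> = t / (s + t)"
  have \<tau>: "0 \<le> \<tau>" "\<tau> \<le> 1" using True by (auto simp: \<tau>_def)
  have "s powr (r - 1) * \<tau> * (r - 1 + \<tau>) \<le> W powr (r - 1) * 1 * r"
    using assms True \<tau> by (intro mult_mono powr_mono2 mult_nonneg_nonneg) auto
  moreover have "t powr (r - 1) * \<tau>\<^sup>2 \<le> W powr (r - 1) * 1"
    using assms True \<tau> by (intro mult_mono powr_mono2) (auto intro: power_le_one)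
  ultimately show ?thesis
    using True by (simp add: gap_slope_def \<tau>_def algebra_simps)
next
  case False
  then show ?thesis using assms by (auto simp: gap_slope_def)
qed

lemma gap_cost_DERIV:
  assumes "s \<noteq> 0" "t \<noteq> 0"
  shows "((\<lambda>s. gap_cost r s t) has_real_derivative gap_slope r s t) (at s)"
proof -
  have "((\<lambda>s. (s, t)) has_derivative (\<lambda>h. (h, 0))) (at s)"
    by (auto intro!: derivative_eq_intros)
  from has_derivative_compose[OF this gap_cost_has_derivative[OF assms, of r]]
  show ?thesis by (simp add: has_field_derivative_def mult_commute_abs)
qed

lemma gap_cost_strict_mono:
  assumes "r \<ge> 1" "0 < s" "s < s'" "t > 0"
  shows "gap_cost r s t < gap_cost r s' t"
proof -
  have "\<exists>y. ((\<lambda>s. gap_cost r s t) has_real_derivative y) (at x) \<and> y > 0" if "s \<le> x" for x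
    using gap_cost_DERIV[of x t r] gap_slope_pos[of r x t] that assms by force
  then show ?thesis using DERIV_pos_imp_increasing[of s s' "\<lambda>s. gap_cost r s t"] assms by blast
qed

lemma gap_cost_nonneg: "0 \<le> gap_cost r s t"
  by (simp add: gap_cost_def)

lemma gap_cost_mono:
  assumes "r \<ge> 1" "s \<le> s'" "t \<le> t'"
  shows "gap_cost r s t \<le> gap_cost r s' t'"
proof (cases "s > 0 \<and> t > 0")
  case True
  have "gap_cost r s t \<le> gap_cost r s' t"
    using gap_cost_strict_mono[of r s s' t] assms True by (cases "s = s'") auto
  also have "\<dots> \<le> gap_cost r s' t'"
    using gap_cost_strict_mono[of r t t' s'] assms True
    by (cases "t = t'") (auto simp: gap_cost_commute[of r s'])
  finally show ?thesis .
next
  case False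
  then have "gap_cost r s t = 0" by (auto simp: gap_cost_def)
  then show ?thesis by (simp add: gap_cost_nonneg)
qed

text \<open>Controls the growth from the kink at \<open>s = 0\<close>, across which the mean value
  theorem cannot be applied.\<close>

lemma gap_cost_le_linear:
  assumes "r \<ge> 1" "s \<le> W" "t \<le> W" "0 < s"
  shows "gap_cost r s t \<le> (r + 1) * W powr (r - 1) * s"
proof (cases "t > 0")
  case True
  have "s powr r = s * s powr (r - 1)" "t powr r = t * t powr (r - 1)"
    using assms True by (simp_all add: powr_diff)
  then have "gap_cost r s t = (t / (s + t)) * (s powr (r - 1) + t powr (r - 1)) * s"
    using assms True by (simp add: gap_cost_def algebra_simps add_divide_distrib)
  also have "\<dots> \<le> 1 * (W powr (r - 1) + W powr (r - 1)) * s"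
    using assms True by (intro mult_mono powr_mono2 add_mono) auto
  \<comment> \<open>The estimate yields the factor 2, which is at most \<open>r + 1\<close>; one
    constant then serves both here and for the slopes.\<close>
  also have "\<dots> \<le> (r + 1) * W powr (r - 1) * s"
    using assms by (intro mult_right_mono) (auto intro!: mult_right_mono)
  finally show ?thesis .
next
  case False
  then show ?thesis using assms by (simp add: gap_cost_def)
qed

text \<open>For positive arguments the mean value theorem and the bound on the slope apply. If
  \<open>s'\<close> is not positive, its cost is 0 and the linear bound from the kink takes
  over.\<close>

lemma gap_cost_lipschitz:
  assumes "r \<ge> 1" "s \<le> W" "s' \<le> W" "t \<le> W"
  shows "\<bar>gap_cost r s t - gap_cost r s' t\<bar> \<le> (r + 1) * W powr (r - 1) * \<bar>s - s'\<bar>"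
proof -
  have le: "\<bar>gap_cost r s t - gap_cost r s' t\<bar> \<le> (r + 1) * W powr (r - 1) * \<bar>s - s'\<bar>"
    if "s' < s" "s \<le> W" for s s'
  proof (cases "s' > 0 \<and> t > 0")
    case True
    have "\<And>x. s' \<le> x \<Longrightarrow> x \<le> s \<Longrightarrow> ((\<lambda>s. gap_cost r s t) has_real_derivative gap_slope r x t) (at x)"
      using True by (intro gap_cost_DERIV) auto
    from MVT2[OF that(1) this] obtain z where z: "s' < z" "z < s"
      "gap_cost r s t - gap_cost r s' t = (s - s') * gap_slope r z t" by blast
    have "gap_slope r z t \<le> (r + 1) * W powr (r - 1)"
      using z that assms by (intro gap_slope_le) auto
    then show ?thesis
      using z that gap_slope_nonneg[of r z t] assms by (simp add: abs_mult mult.commute mult_left_mono)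
  next
    case False
    show ?thesis
    proof (cases "s > 0 \<and> t > 0")
      case True
      then have "s' \<le> 0" using False by auto
      have "gap_cost r s t \<le> (r + 1) * W powr (r - 1) * s"
        using True that assms by (intro gap_cost_le_linear) auto
      also have "\<dots> \<le> (r + 1) * W powr (r - 1) * (s - s')"
        using \<open>s' \<le> 0\<close> assms by (intro mult_left_mono) auto
      finally show ?thesis
        using \<open>s' \<le> 0\<close> that gap_cost_nonneg[of r s t] by (simp add: gap_cost_def[of r s'])
    next
      case f: False
      then have "gap_cost r s t = 0" "gap_cost r s' t = 0"
        using False by (auto simp: gap_cost_def)
      then show ?thesis using assms by simp
    qed
  qed
  show ?thesis
    using le[of s' s] le[of s s'] assms by (cases s s' rule: linorder_cases) (auto simp: abs_minus_commute)
qed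

lemma gap_cost_lipschitz2:
  assumes "r \<ge> 1" "s \<le> W" "s' \<le> W" "t \<le> W" "t' \<le> W"
  shows "\<bar>gap_cost r s t - gap_cost r s' t'\<bar> \<le> (r + 1) * W powr (r - 1) * (\<bar>s - s'\<bar> + \<bar>t - t'\<bar>)"
  using gap_cost_lipschitz[of r s W s' t] gap_cost_lipschitz[of r t W t' s'] assms
  by (simp add: gap_cost_commute[of r s'] distrib_left)

lemma borel_measurable_gap_cost [measurable]:
  assumes [measurable]: "f \<in> borel_measurable M" "g \<in> borel_measurable M"
  shows "(\<lambda>x. gap_cost r (f x) (g x)) \<in> borel_measurable M"
  unfolding gap_cost_def by measurable

lemma borel_measurable_gap_slope [measurable]:
  assumes [measurable]: "f \<in> borel_measurable M" "g \<in> borel_measurable M"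
  shows "(\<lambda>x. gap_slope r (f x) (g x)) \<in> borel_measurable M"
  unfolding gap_slope_def by measurable

section \<open>Differentiation under the integral sign\<close>

text \<open>Along any sequence tending to \<open>p\<close>, the normalized remainders are at most
  \<open>2 * C\<close> almost everywhere and tend to 0 almost everywhere, so dominated convergence
  applies. Kinks of the integrand are harmless as long as almost no \<xi> has one at the given point
  \<open>p\<close>.\<close>

lemma (in finite_measure) has_derivative_integral_lipschitz:
  fixes H :: "'b::real_normed_vector \<Rightarrow> 'a \<Rightarrow> real"
  assumes int: "\<And>q. q \<in> S \<Longrightarrow> integrable M (H q)" and p: "p \<in> S"
    and int': "\<And>h. integrable M (\<lambda>\<xi>. H' \<xi> h)"
    and der: "AE \<xi> in M. ((\<lambda>q. H q \<xi>) has_derivative H' \<xi>) (at p within S)"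
    and lip: "\<And>q. q \<in> S \<Longrightarrow> AE \<xi> in M. \<bar>H q \<xi> - H p \<xi>\<bar> \<le> C * norm (q - p)"
    and bd: "\<And>h. AE \<xi> in M. \<bar>H' \<xi> h\<bar> \<le> C * norm h"
  shows "((\<lambda>q. LINT \<xi>|M. H q \<xi>) has_derivative (\<lambda>h. LINT \<xi>|M. H' \<xi> h)) (at p within S)"
  unfolding has_derivative_iff_norm
proof
  have lin: "AE \<xi> in M. bounded_linear (H' \<xi>)"
    using der by eventually_elim (rule has_derivative_bounded_linear)
  show "bounded_linear (\<lambda>h. LINT \<xi>|M. H' \<xi> h)"
  proof (rule bounded_linear_intro)
    fix h k :: 'b and c :: real
    \<comment> \<open>Linearity of \<open>H' \<xi>\<close> is known only where the derivative
      exists, that is, for almost every \<xi>.\<close>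
    have "(LINT \<xi>|M. H' \<xi> (h + k)) = (LINT \<xi>|M. H' \<xi> h + H' \<xi> k)"
      using lin int' by (intro integral_cong_AE) (auto simp: bounded_linear.linear linear_add elim: eventually_mono)
    then show "(LINT \<xi>|M. H' \<xi> (h + k)) = (LINT \<xi>|M. H' \<xi> h) + (LINT \<xi>|M. H' \<xi> k)"
      using int' by simp
    have "(LINT \<xi>|M. H' \<xi> (c *\<^sub>R h)) = (LINT \<xi>|M. c *\<^sub>R H' \<xi> h)"
      using lin int' by (intro integral_cong_AE) (auto simp: bounded_linear.linear linear_scale elim: eventually_mono)
    then show "(LINT \<xi>|M. H' \<xi> (c *\<^sub>R h)) = c *\<^sub>R (LINT \<xi>|M. H' \<xi> h)"
      using int' by simp
    have "norm (LINT \<xi>|M. H' \<xi> h) \<le> (LINT \<xi>|M. C * norm h)"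
      using bd[of h] int' by (intro order_trans[OF integral_norm_bound] integral_mono_AE) auto
    then show "norm (LINT \<xi>|M. H' \<xi> h) \<le> norm h * (C * measure M (space M))"
      by (simp add: mult_ac)
  qed
  show "((\<lambda>q. norm ((LINT \<xi>|M. H q \<xi>) - (LINT \<xi>|M. H p \<xi>) - (LINT \<xi>|M. H' \<xi> (q - p))) / norm (q - p)) \<longlongrightarrow> 0)
     (at p within S)"
    unfolding tendsto_at_iff_sequentially
  proof (intro allI impI)
    fix X assume X: "\<forall>i. X i \<in> S - {p}" "X \<longlonglongrightarrow> p"
    define E where "E i \<xi> = norm (H (X i) \<xi> - H p \<xi> - H' \<xi> (X i - p)) / norm (X i - p)" for i \<xi>
    have Eint: "integrable M (E i)" for i
      unfolding E_def using X int int' p by (intro integrable_divide_zero integrable_norm Bochner_Integration.integrable_diff) auto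
    have "(\<lambda>i. LINT \<xi>|M. E i \<xi>) \<longlonglongrightarrow> (LINT \<xi>|M. 0)"
    proof (rule integral_dominated_convergence[where w = "\<lambda>_. 2 * C"])
      show "AE \<xi> in M. (\<lambda>i. E i \<xi>) \<longlonglongrightarrow> 0"
        using der
      proof eventually_elim
        case (elim \<xi>)
        then show ?case
          using X unfolding E_def has_derivative_iff_norm tendsto_at_iff_sequentially comp_def by blast
      qed
      fix i
      have "X i \<in> S" "X i \<noteq> p" using X by auto
      show "AE \<xi> in M. norm (E i \<xi>) \<le> 2 * C"
        using lip[OF \<open>X i \<in> S\<close>] bd[of "X i - p"]
      proof eventually_elim
        case (elim \<xi>)
        then have "\<bar>H (X i) \<xi> - H p \<xi> - H' \<xi> (X i - p)\<bar> \<le> C * norm (X i - p) + C * norm (X i - p)" by linarith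
        then show ?case using \<open>X i \<noteq> p\<close> by (simp add: E_def divide_le_eq)
      qed
    qed (use Eint in auto)
    then have lim: "(\<lambda>i. LINT \<xi>|M. E i \<xi>) \<longlonglongrightarrow> 0" by simp
    show "((\<lambda>q. norm ((LINT \<xi>|M. H q \<xi>) - (LINT \<xi>|M. H p \<xi>) - (LINT \<xi>|M. H' \<xi> (q - p))) / norm (q - p)) \<circ> X) \<longlonglongrightarrow> 0"
      unfolding comp_def
    proof (rule tendsto_sandwich[OF _ _ tendsto_const lim])
      show "\<forall>\<^sub>F i in sequentially. norm ((LINT \<xi>|M. H (X i) \<xi>) - (LINT \<xi>|M. H p \<xi>) - (LINT \<xi>|M. H' \<xi> (X i - p))) / norm (X i - p)
        \<le> (LINT \<xi>|M. E i \<xi>)"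
      proof (intro always_eventually allI)
        fix i
        have "X i \<in> S" "X i \<noteq> p" using X by auto
        have "(LINT \<xi>|M. H (X i) \<xi>) - (LINT \<xi>|M. H p \<xi>) - (LINT \<xi>|M. H' \<xi> (X i - p)) =
          (LINT \<xi>|M. H (X i) \<xi> - H p \<xi> - H' \<xi> (X i - p))"
          using int int' p \<open>X i \<in> S\<close> by simp
        then have "norm ((LINT \<xi>|M. H (X i) \<xi>) - (LINT \<xi>|M. H p \<xi>) - (LINT \<xi>|M. H' \<xi> (X i - p))) \<le>
          (LINT \<xi>|M. norm (H (X i) \<xi> - H p \<xi> - H' \<xi> (X i - p)))"
          using integral_norm_bound by metis
        then show "norm ((LINT \<xi>|M. H (X i) \<xi>) - (LINT \<xi>|M. H p \<xi>) - (LINT \<xi>|M. H' \<xi> (X i - p))) / norm (X i - p)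
          \<le> (LINT \<xi>|M. E i \<xi>)"
          unfolding E_def by (simp add: divide_right_mono)
      qed
    qed simp
  qed
qed

section \<open>The law on [a, b] and the error of a single cell\<close>

definition cell_error :: "real \<Rightarrow> real measure \<Rightarrow> real \<Rightarrow> real \<Rightarrow> real" where
  "cell_error r \<mu> u v = (LINT \<xi>|\<mu>. gap_cost r (\<xi> - u) (v - \<xi>))"

lemma gap_cost_le:
  assumes "r \<ge> 1" "s \<le> W" "t \<le> W" "0 \<le> W"
  shows "gap_cost r s t \<le> (r + 1) * W powr (r - 1) * W"
proof (cases "s > 0")
  case True
  then have "gap_cost r s t \<le> (r + 1) * W powr (r - 1) * s"
    using gap_cost_le_linear assms by blast
  also have "\<dots> \<le> (r + 1) * W powr (r - 1) * W"
    using assms by (intro mult_left_mono) auto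
  finally show ?thesis .
next
  case False
  then show ?thesis using assms by (simp add: gap_cost_def)
qed

lemma emeasure_support:
  "\<lbrakk>x \<in> measure_support \<mu>; open U; x \<in> U\<rbrakk> \<Longrightarrow> emeasure \<mu> U \<noteq> 0"
  by (auto simp: measure_support_def)

text \<open>Every point outside the support has an open null neighbourhood. By the Lindelof property
  countably many of these cover \<open>U\<close>.\<close>

lemma emeasure_disjoint_support:
  assumes sets: "sets \<mu> = sets borel" and U: "open U" "U \<inter> measure_support \<mu> = {}"
  shows "emeasure \<mu> U = 0"
proof -
  define F where "F = {V. open V \<and> V \<subseteq> U \<and> emeasure \<mu> V = 0}"
  obtain F' where F': "F' \<subseteq> F" "countable F'" "\<Union>F' = \<Union>F"
    using Lindelof[of F] by (auto simp: F_def)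
  have "U \<subseteq> \<Union>F"
  proof
    fix x assume "x \<in> U"
    then have "x \<notin> measure_support \<mu>" using U by blast
    then obtain V where V: "open V" "x \<in> V" "emeasure \<mu> V = 0"
      by (auto simp: measure_support_def)
    then have "emeasure \<mu> (U \<inter> V) \<le> 0"
      using emeasure_mono[of "U \<inter> V" V \<mu>] sets by auto
    then have "U \<inter> V \<in> F" using U V by (auto simp: F_def)
    then show "x \<in> \<Union>F" using \<open>x \<in> U\<close> V by blast
  qed
  then have "U = (\<Union>V\<in>F'. V)" using F' by (auto simp: F_def)
  moreover have "(\<Union>V\<in>F'. V) \<in> null_sets \<mu>"
    using F' sets by (intro null_sets_UN') (auto simp: F_def null_sets_def)
  ultimately show ?thesis by auto
qed

locale interval_law = prob_space \<mu> for \<mu> :: "real measure" +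
  fixes r a b :: real
  assumes sets_mu [measurable_cong]: "sets \<mu> = sets borel"
    and r: "r \<ge> 1" and ab: "a < b"
    and atomless: "emeasure \<mu> {x} = 0"
    and hull: "convex hull (measure_support \<mu>) = {a..b}"
begin

lemma space_mu: "space \<mu> = UNIV"
  using sets_eq_imp_space_eq[OF sets_mu] by simp

lemma AE_neq: "AE \<xi> in \<mu>. \<xi> \<noteq> x"
  by (rule AE_I[of _ _ "{x}"]) (auto simp: atomless sets_mu)

lemma AE_notin: "finite A \<Longrightarrow> AE \<xi> in \<mu>. \<xi> \<notin> A"
proof (induction A rule: finite_induct)
  case (insert x A)
  show ?case using insert.IH AE_neq[of x] by eventually_elim auto
qed simp

lemma AE_inside: "AE \<xi> in \<mu>. a < \<xi> \<and> \<xi> < b"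
proof -
  have "measure_support \<mu> \<subseteq> {a..b}"
    using hull_subset[of "measure_support \<mu>" convex] hull by simp
  then have "emeasure \<mu> (- {a..b}) = 0"
    by (intro emeasure_disjoint_support sets_mu) auto
  then have "AE \<xi> in \<mu>. \<xi> \<in> {a..b}"
    by (intro AE_I[of _ _ "- {a..b}"]) (auto simp: sets_mu)
  then show ?thesis using AE_neq[of a] AE_neq[of b] by eventually_elim auto
qed

text \<open>Open half-lines are convex: a support contained in \<open>{a<..}\<close> or in
  \<open>{..<b}\<close> would have a convex hull that misses \<open>a\<close> or
  \<open>b\<close>.\<close>

lemma support_endpoints: "a \<in> measure_support \<mu>" "b \<in> measure_support \<mu>"
proof -
  have sub: "measure_support \<mu> \<subseteq> {a..b}"
    using hull_subset[of "measure_support \<mu>" convex] hull by simp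
  have "\<not> measure_support \<mu> \<subseteq> {a<..}"
    using hull_minimal[of "measure_support \<mu>" "{a<..}" convex] subsetD[of "{a..b}" "{a<..}" a] ab hull by auto
  moreover have "\<not> measure_support \<mu> \<subseteq> {..<b}"
    using hull_minimal[of "measure_support \<mu>" "{..<b}" convex] subsetD[of "{a..b}" "{..<b}" b] ab hull by auto
  ultimately obtain x y where "x \<in> measure_support \<mu>" "y \<in> measure_support \<mu>" "x \<le> a" "b \<le> y"
    by (auto simp: subset_eq not_less)
  then have "x = a" "y = b" using sub by auto
  then show "a \<in> measure_support \<mu>" "b \<in> measure_support \<mu>"
    using \<open>x \<in> measure_support \<mu>\<close> \<open>y \<in> measure_support \<mu>\<close> by auto
qed

text \<open>The neighbourhood \<open>{..<t}\<close> of the support point \<open>a\<close> has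
  positive mass, and almost all of that mass lies to the right of \<open>a\<close>.\<close>

lemma pos_left:
  assumes "a < t"
  shows "emeasure \<mu> {a<..<t} \<noteq> 0"
proof
  assume "emeasure \<mu> {a<..<t} = 0"
  then have "AE \<xi> in \<mu>. \<xi> \<notin> {a<..<t}" by (intro AE_I[of _ _ "{a<..<t}"]) (auto simp: sets_mu)
  then have "AE \<xi> in \<mu>. \<xi> \<notin> {..<t}" using AE_inside by eventually_elim auto
  then have "emeasure \<mu> {..<t} = 0" by (simp add: AE_iff_measurable[OF _ refl] sets_mu space_mu lessThan_def greaterThan_def)
  then show False using emeasure_support[OF support_endpoints(1), of "{..<t}"] assms by simp
qed

lemma pos_right:
  assumes "t < b"
  shows "emeasure \<mu> {t<..<b} \<noteq> 0"
proof
  assume "emeasure \<mu> {t<..<b} = 0"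
  then have "AE \<xi> in \<mu>. \<xi> \<notin> {t<..<b}" by (intro AE_I[of _ _ "{t<..<b}"]) (auto simp: sets_mu)
  then have "AE \<xi> in \<mu>. \<xi> \<notin> {t<..}" using AE_inside by eventually_elim auto
  then have "emeasure \<mu> {t<..} = 0" by (simp add: AE_iff_measurable[OF _ refl] sets_mu space_mu lessThan_def greaterThan_def)
  then show False using emeasure_support[OF support_endpoints(2), of "{t<..}"] assms by simp
qed

lemma integrable_gap_cost: "integrable \<mu> (\<lambda>\<xi>. gap_cost r (\<xi> - u) (v - \<xi>))"
proof -
  define W where "W = \<bar>u\<bar> + \<bar>v\<bar> + \<bar>a\<bar> + \<bar>b\<bar>"
  show ?thesis
  proof (rule integrable_const_bound)
    show "AE \<xi> in \<mu>. norm (gap_cost r (\<xi> - u) (v - \<xi>)) \<le> (r + 1) * W powr (r - 1) * W"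
      using AE_inside
    proof eventually_elim
      case (elim \<xi>)
      then have "\<xi> - u \<le> W" "v - \<xi> \<le> W" "0 \<le> W" by (auto simp: W_def)
      then show ?case using r by (simp add: gap_cost_le gap_cost_nonneg)
    qed
  qed simp
qed

lemma integrable_gap_slope:
  "integrable \<mu> (\<lambda>\<xi>. gap_slope r (\<xi> - u) (v - \<xi>))"
  "integrable \<mu> (\<lambda>\<xi>. gap_slope r (v - \<xi>) (\<xi> - u))"
proof -
  define W where "W = \<bar>u\<bar> + \<bar>v\<bar> + \<bar>a\<bar> + \<bar>b\<bar>"
  have "AE \<xi> in \<mu>. norm (gap_slope r (\<xi> - u) (v - \<xi>)) \<le> (r + 1) * W powr (r - 1)
       \<and> norm (gap_slope r (v - \<xi>) (\<xi> - u)) \<le> (r + 1) * W powr (r - 1)"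
    using AE_inside
  proof eventually_elim
    case (elim \<xi>)
    then have "\<xi> - u \<le> W" "v - \<xi> \<le> W" by (auto simp: W_def)
    then show ?case using r by (simp add: gap_slope_le gap_slope_nonneg)
  qed
  then show "integrable \<mu> (\<lambda>\<xi>. gap_slope r (\<xi> - u) (v - \<xi>))"
    "integrable \<mu> (\<lambda>\<xi>. gap_slope r (v - \<xi>) (\<xi> - u))"
    by (auto intro!: integrable_const_bound[where B = "(r + 1) * W powr (r - 1)"] elim: eventually_mono)
qed

text \<open>The integrand has kinks only at \<xi> = u and \<xi> = v, which are null sets because the
  law is atomless. The case \<open>u = v\<close> is included, as it occurs on the boundary of the
  closed simplex.\<close>

lemma cell_error_has_derivative:
  assumes "u \<in> {a..b}" "v \<in> {a..b}"
  shows "((\<lambda>p. cell_error r \<mu> (fst p) (snd p)) has_derivative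
     (\<lambda>h. (LINT \<xi>|\<mu>. gap_slope r (v - \<xi>) (\<xi> - u)) * snd h
         - (LINT \<xi>|\<mu>. gap_slope r (\<xi> - u) (v - \<xi>)) * fst h)) (at (u, v))"
proof -
  \<comment> \<open>The enlarged square is an open neighbourhood even when \<open>u\<close> or
    \<open>v\<close> is an end of [a, b]. \<open>W\<close> bounds every distance from a point of (a,
    b) to an end of a cell given by a point of \<open>S\<close>.\<close>
  define S where "S = {a - 1<..<b + 1} \<times> {a - 1<..<b + 1}"
  define W where "W = b - a + 1"
  define H' where "H' \<xi> h = gap_slope r (v - \<xi>) (\<xi> - u) * snd h - gap_slope r (\<xi> - u) (v - \<xi>) * fst h"
    for \<xi> and h :: "real \<times> real"
  have S: "open S" "(u, v) \<in> S" using assms by (auto simp: S_def intro!: open_Times)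
  have "((\<lambda>p. LINT \<xi>|\<mu>. gap_cost r (\<xi> - fst p) (snd p - \<xi>)) has_derivative (\<lambda>h. LINT \<xi>|\<mu>. H' \<xi> h)) (at (u, v) within S)"
  proof (rule has_derivative_integral_lipschitz[where C = "2 * ((r + 1) * W powr (r - 1))"])
    show "AE \<xi> in \<mu>. ((\<lambda>p. gap_cost r (\<xi> - fst p) (snd p - \<xi>)) has_derivative H' \<xi>) (at (u, v) within S)"
      using AE_neq[of u] AE_neq[of v]
    proof eventually_elim
      case (elim \<xi>)
      have "((\<lambda>p. (\<xi> - fst p, snd p - \<xi>)) has_derivative (\<lambda>h. (- fst h, snd h))) (at (u, v) within S)"
        by (auto intro!: derivative_eq_intros)
      from has_derivative_compose[OF this, of "\<lambda>p. gap_cost r (fst p) (snd p)"] gap_cost_has_derivative[of "\<xi> - u" "v - \<xi>" r] elim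
      have "((\<lambda>p. gap_cost r (\<xi> - fst p) (snd p - \<xi>)) has_derivative
        (\<lambda>h. gap_slope r (\<xi> - u) (v - \<xi>) * - fst h + gap_slope r (v - \<xi>) (\<xi> - u) * snd h)) (at (u, v) within S)"
        by fastforce
      then show ?case by (rule has_derivative_eq_rhs) (auto simp: H'_def)
    qed
    fix q assume q: "q \<in> S"
    show "AE \<xi> in \<mu>. \<bar>gap_cost r (\<xi> - fst q) (snd q - \<xi>) - gap_cost r (\<xi> - fst (u, v)) (snd (u, v) - \<xi>)\<bar>
          \<le> 2 * ((r + 1) * W powr (r - 1)) * norm (q - (u, v))"
      using AE_inside
    proof eventually_elim
      case (elim \<xi>)
      have "\<bar>gap_cost r (\<xi> - fst q) (snd q - \<xi>) - gap_cost r (\<xi> - u) (v - \<xi>)\<bar>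
        \<le> (r + 1) * W powr (r - 1) * (\<bar>\<xi> - fst q - (\<xi> - u)\<bar> + \<bar>snd q - \<xi> - (v - \<xi>)\<bar>)"
        using r elim q assms by (intro gap_cost_lipschitz2) (auto simp: S_def W_def)
      also have "\<dots> \<le> (r + 1) * W powr (r - 1) * (2 * norm (q - (u, v)))"
        using norm_fst_le[of "fst q - u" "snd q - v"] norm_snd_le[of "snd q - v" "fst q - u"] r
        by (intro mult_left_mono) (auto simp: minus_prod_def)
      finally show ?case by simp
    qed
  next
    fix h
    show "integrable \<mu> (\<lambda>\<xi>. H' \<xi> h)"
      unfolding H'_def by (intro Bochner_Integration.integrable_diff integrable_mult_left integrable_gap_slope)
    show "AE \<xi> in \<mu>. \<bar>H' \<xi> h\<bar> \<le> 2 * ((r + 1) * W powr (r - 1)) * norm h"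
      using AE_inside
    proof eventually_elim
      case (elim \<xi>)
      define K where "K = (r + 1) * W powr (r - 1)"
      have K: "gap_slope r (v - \<xi>) (\<xi> - u) \<le> K" "gap_slope r (\<xi> - u) (v - \<xi>) \<le> K"
        unfolding K_def using elim assms r by (auto intro!: gap_slope_le simp: W_def)
      have nn: "0 \<le> gap_slope r (v - \<xi>) (\<xi> - u)" "0 \<le> gap_slope r (\<xi> - u) (v - \<xi>)"
        using r by (auto intro: gap_slope_nonneg)
      have h: "\<bar>fst h\<bar> \<le> norm h" "\<bar>snd h\<bar> \<le> norm h"
        using norm_fst_le[of "fst h" "snd h"] norm_snd_le[of "snd h" "fst h"] by simp_all
      have "\<bar>H' \<xi> h\<bar> \<le> \<bar>gap_slope r (v - \<xi>) (\<xi> - u) * snd h\<bar> + \<bar>gap_slope r (\<xi> - u) (v - \<xi>) * fst h\<bar>"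
        unfolding H'_def by (rule abs_triangle_ineq4)
      also have "\<dots> \<le> K * norm h + K * norm h"
        unfolding abs_mult using K nn h by (intro add_mono mult_mono) auto
      finally show ?case unfolding K_def by (simp add: mult_ac)
    qed
  qed (use S integrable_gap_cost in auto)
  then have "((\<lambda>p. cell_error r \<mu> (fst p) (snd p)) has_derivative (\<lambda>h. LINT \<xi>|\<mu>. H' \<xi> h)) (at (u, v))"
    using at_within_open[OF S(2,1)] by (simp add: cell_error_def)
  moreover have "(LINT \<xi>|\<mu>. H' \<xi> h) = (LINT \<xi>|\<mu>. gap_slope r (v - \<xi>) (\<xi> - u)) * snd h
         - (LINT \<xi>|\<mu>. gap_slope r (\<xi> - u) (v - \<xi>)) * fst h" for h
    unfolding H'_def by (simp add: integrable_gap_slope)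
  ultimately show ?thesis by simp
qed

end

section \<open>Pointwise cost of a grid and its behaviour under refinement\<close>

text \<open>For sorted \<open>xs\<close> at most one summand is nonzero, that of the gap around
  \<xi>. This permits comparing two grids for each \<xi> separately before integrating.\<close>

definition grid_cost :: "real \<Rightarrow> real list \<Rightarrow> real \<Rightarrow> real" where
  "grid_cost r xs \<xi> = (\<Sum>i<length xs - 1. gap_cost r (\<xi> - xs ! i) (xs ! Suc i - \<xi>))"

lemma grid_cost_Cons:
  "grid_cost r (x # y # zs) \<xi> = gap_cost r (\<xi> - x) (y - \<xi>) + grid_cost r (y # zs) \<xi>"
  unfolding grid_cost_def by (simp add: sum.lessThan_Suc_shift del: sum.lessThan_Suc)

lemma grid_cost_eq_0:
  assumes "sorted xs" "\<And>x. x \<in> set xs \<Longrightarrow> \<xi> < x"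
  shows "grid_cost r xs \<xi> = 0"
  unfolding grid_cost_def
proof (intro sum.neutral ballI)
  fix i assume "i \<in> {..<length xs - 1}"
  then have "\<xi> < xs ! i" using assms(2) nth_mem[of i xs] by auto
  then show "gap_cost r (\<xi> - xs ! i) (xs ! Suc i - \<xi>) = 0" by (simp add: gap_cost_def)
qed

text \<open>Repeated entries are allowed: they occur for boundary vectors of the closed simplex.\<close>

lemma grid_cost_eq_gap_cost:
  assumes "sorted xs" "\<xi> \<notin> set xs" "u \<in> set xs" "v \<in> set xs" "u < \<xi>" "\<xi> < v"
    and "set xs \<inter> {u<..<v} = {}"
  shows "grid_cost r xs \<xi> = gap_cost r (\<xi> - u) (v - \<xi>)"
  using assms
proof (induction xs)
  case (Cons x xs)
  show ?case
  proof (cases xs)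
    case Nil
    then show ?thesis using Cons.prems by auto
  next
    case (Cons y zs)
    have xy: "x \<le> y" "\<And>z. z \<in> set zs \<Longrightarrow> y \<le> z" "sorted xs" using Cons.prems(1) Cons by auto
    show ?thesis
    \<comment> \<open>Either \<xi> lies in the first gap and the tail contributes 0, or the first
      gap contributes 0 and the induction hypothesis handles the tail.\<close>
    proof (cases "\<xi> < y")
      case True
      then have "grid_cost r xs \<xi> = 0"
        using xy Cons by (intro grid_cost_eq_0) fastforce+
      moreover have "z > \<xi>" if "z \<in> set xs" for z using that True xy(2) Cons by fastforce
      then have "x = u" using Cons.prems(3,5) by force
      moreover have "v = y"
      proof -
        have "y \<le> v" using Cons.prems(4,5,6) \<open>x = u\<close> xy(2) Cons by fastforce
        moreover have "y \<notin> {u<..<v}" using Cons.prems(7) Cons by auto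
        ultimately show ?thesis using True \<open>u < \<xi>\<close> by auto
      qed
      ultimately show ?thesis using Cons by (simp add: grid_cost_Cons)
    next
      case False
      then have "y < \<xi>" using Cons.prems(2) Cons by (cases "y = \<xi>") auto
      then have "gap_cost r (\<xi> - x) (y - \<xi>) = 0" by (simp add: gap_cost_def)
      moreover have "grid_cost r xs \<xi> = gap_cost r (\<xi> - u) (v - \<xi>)"
      proof (rule Cons.IH)
        show "u \<in> set xs"
        \<comment> \<open>If \<open>u\<close> is the head, the second entry repeats it, since no
          node lies strictly between \<open>u\<close> and \<open>v\<close>; so \<open>u\<close>
          survives in the tail.\<close>
        proof (cases "u = x")
          case True
          have "y \<notin> {u<..<v}" using Cons.prems(7) Cons by auto
          then have "y = u" using True xy(1) \<open>y < \<xi>\<close> \<open>\<xi> < v\<close> by auto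
          then show ?thesis using Cons by simp
        qed (use Cons.prems(3) in auto)
        show "v \<in> set xs"
          using Cons.prems(4,6) \<open>y < \<xi>\<close> xy(1) by auto
      qed (use Cons.prems xy in auto)
      ultimately show ?thesis using Cons by (simp add: grid_cost_Cons)
    qed
  qed
qed simp

lemma finite_gap_exists:
  fixes \<xi> :: "'a::linorder"
  assumes "finite A" "\<xi> \<notin> A" "p \<in> A" "q \<in> A" "p < \<xi>" "\<xi> < q"
  obtains u v where "u \<in> A" "v \<in> A" "u < \<xi>" "\<xi> < v" "A \<inter> {u<..<v} = {}"
proof
  let ?L = "{x \<in> A. x < \<xi>}" and ?U = "{x \<in> A. \<xi> < x}"
  have L: "finite ?L" "?L \<noteq> {}" and U: "finite ?U" "?U \<noteq> {}" using assms by auto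
  show "Max ?L \<in> A" "Max ?L < \<xi>" using Max_in[OF L] by auto
  show "Min ?U \<in> A" "\<xi> < Min ?U" using Min_in[OF U] by auto
  show "A \<inter> {Max ?L<..<Min ?U} = {}"
  proof (intro equals0I)
    fix x assume "x \<in> A \<inter> {Max ?L<..<Min ?U}"
    then have x: "x \<in> A" "Max ?L < x" "x < Min ?U" by auto
    then have "x \<noteq> \<xi>" using assms(2) by auto
    then have "x \<in> ?L \<or> x \<in> ?U" using x by auto
    then show False using Max_ge[OF L(1), of x] Min_le[OF U(1), of x] x by auto
  qed
qed

text \<open>Both costs are that of the gap around \<xi> in the common set of nodes; \<open>p\<close>
  and \<open>q\<close> ensure that such a gap exists.\<close>

lemma grid_cost_set_cong:
  assumes "sorted xs" "sorted ys" "set xs = set ys" "\<xi> \<notin> set xs"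
    "p \<in> set xs" "q \<in> set xs" "p < \<xi>" "\<xi> < q"
  shows "grid_cost r xs \<xi> = grid_cost r ys \<xi>"
proof -
  obtain u v where "u \<in> set xs" "v \<in> set xs" "u < \<xi>" "\<xi> < v" "set xs \<inter> {u<..<v} = {}"
    using finite_gap_exists[of "set xs" \<xi> p q] assms by auto
  then show ?thesis using assms by (simp add: grid_cost_eq_gap_cost)
qed

text \<open>The gap of \<open>xs\<close> around \<xi> lies inside that of \<open>ys\<close>: an end
  of the latter is a node of \<open>xs\<close> if it lies in (a, b), and otherwise it lies beyond
  the node \<open>a\<close> or \<open>b\<close>. The second claim says that a node \<open>z\<close>
  not separated from \<xi> by \<open>ys\<close> cuts the gap of \<open>ys\<close>, so that at least
  one distance strictly decreases.\<close>

lemma grid_cost_le: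
  assumes r: "r \<ge> 1" and xs: "sorted xs" "a \<in> set xs" "b \<in> set xs" and ys: "sorted ys"
    and \<xi>: "\<xi> \<notin> set xs" "\<xi> \<notin> set ys" "a < \<xi>" "\<xi> < b"
    and sub: "set ys \<inter> {a<..<b} \<subseteq> set xs"
    and pq: "p \<in> set ys" "q \<in> set ys" "p < \<xi>" "\<xi> < q"
  shows "grid_cost r xs \<xi> \<le> grid_cost r ys \<xi>"
    and "\<lbrakk>z \<in> set xs; \<And>u. u \<in> set ys \<Longrightarrow> \<not> (z \<le> u \<and> u \<le> \<xi>) \<and> \<not> (\<xi> \<le> u \<and> u \<le> z)\<rbrakk> \<Longrightarrow>
      grid_cost r xs \<xi> < grid_cost r ys \<xi>"
proof -
  obtain u v where uv: "u \<in> set ys" "v \<in> set ys" "u < \<xi>" "\<xi> < v" "set ys \<inter> {u<..<v} = {}"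
    using finite_gap_exists[of "set ys" \<xi> p q] \<xi> pq by auto
  obtain u' v' where uv': "u' \<in> set xs" "v' \<in> set xs" "u' < \<xi>" "\<xi> < v'" "set xs \<inter> {u'<..<v'} = {}"
    using finite_gap_exists[of "set xs" \<xi> a b] \<xi> xs by auto
  have eq: "grid_cost r xs \<xi> = gap_cost r (\<xi> - u') (v' - \<xi>)" "grid_cost r ys \<xi> = gap_cost r (\<xi> - u) (v - \<xi>)"
    using grid_cost_eq_gap_cost uv uv' xs ys \<xi> by auto
  have inside: "x \<le> u' \<or> v' \<le> x" if "x \<in> set xs" for x using that uv'(5) by force
  have "u \<le> u'"
  proof (cases "u \<le> a")
    case True then show ?thesis using inside[OF xs(2)] \<xi> uv' by linarith
  next
    case False
    then have "u \<in> set xs" using uv \<xi> sub by auto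
    then show ?thesis using inside[of u] uv uv' by linarith
  qed
  moreover have "v' \<le> v"
  proof (cases "b \<le> v")
    case True then show ?thesis using inside[OF xs(3)] \<xi> uv' by linarith
  next
    case False
    then have "v \<in> set xs" using uv \<xi> sub by auto
    then show ?thesis using inside[of v] uv uv' by linarith
  qed
  ultimately show "grid_cost r xs \<xi> \<le> grid_cost r ys \<xi>"
    unfolding eq using r by (intro gap_cost_mono) auto
  assume z: "z \<in> set xs" "\<And>u. u \<in> set ys \<Longrightarrow> \<not> (z \<le> u \<and> u \<le> \<xi>) \<and> \<not> (\<xi> \<le> u \<and> u \<le> z)"
  then have "u < z" "z < v"
    using uv by force+
  then have "u < u' \<or> v' < v"
    using inside[OF z(1)] \<open>u \<le> u'\<close> \<open>v' \<le> v\<close> by linarith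
  then show "grid_cost r xs \<xi> < grid_cost r ys \<xi>"
  proof
    assume "u < u'"
    have "gap_cost r (\<xi> - u') (v' - \<xi>) < gap_cost r (\<xi> - u) (v' - \<xi>)"
      using \<open>u < u'\<close> uv' r by (intro gap_cost_strict_mono) auto
    also have "\<dots> \<le> gap_cost r (\<xi> - u) (v - \<xi>)"
      using r \<open>v' \<le> v\<close> by (intro gap_cost_mono) auto
    finally show ?thesis unfolding eq .
  next
    assume "v' < v"
    have "gap_cost r (\<xi> - u') (v' - \<xi>) < gap_cost r (\<xi> - u') (v - \<xi>)"
      using gap_cost_strict_mono[of r "v' - \<xi>" "v - \<xi>" "\<xi> - u'"] \<open>v' < v\<close> uv' r
      by (simp add: gap_cost_commute[of r "\<xi> - u'" "v' - \<xi>"] gap_cost_commute[of r "\<xi> - u'" "v - \<xi>"])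
    also have "\<dots> \<le> gap_cost r (\<xi> - u) (v - \<xi>)"
      using r \<open>u \<le> u'\<close> by (intro gap_cost_mono) auto
    finally show ?thesis unfolding eq .
  qed
qed

text \<open>The cost vanishes at \<xi> = u, so the half-open cells of \<open>dual_error\<close> and
  the open cells of \<open>dual_distortion\<close> both give the integral of the extension by
  0.\<close>

lemma set_integral_cell_cost:
  "(LINT \<xi>:{u..<v}|\<mu>. cell_cost r u v \<xi>) = cell_error r \<mu> u v"
  "(LINT \<xi>:{u<..<v}|\<mu>. cell_cost r u v \<xi>) = cell_error r \<mu> u v"
proof -
  have "indicat_real {u..<v} \<xi> *\<^sub>R cell_cost r u v \<xi> = gap_cost r (\<xi> - u) (v - \<xi>)" for \<xi>
  proof (cases "u < \<xi> \<and> \<xi> < v")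
    case False
    then show ?thesis by (cases "\<xi> = u") (auto simp: cell_cost_def gap_cost_def)
  qed (simp add: cell_cost_eq_gap_cost)
  moreover have "indicat_real {u<..<v} \<xi> *\<^sub>R cell_cost r u v \<xi> = gap_cost r (\<xi> - u) (v - \<xi>)" for \<xi>
    by (cases "u < \<xi> \<and> \<xi> < v") (auto simp: cell_cost_eq_gap_cost gap_cost_def)
  ultimately show "(LINT \<xi>:{u..<v}|\<mu>. cell_cost r u v \<xi>) = cell_error r \<mu> u v"
    "(LINT \<xi>:{u<..<v}|\<mu>. cell_cost r u v \<xi>) = cell_error r \<mu> u v"
    unfolding set_lebesgue_integral_def cell_error_def by presburger+
qed

lemma dual_distortion_eq_cell_error:
  "dual_distortion r \<mu> a b x =
    (\<Sum>i<length (nodes a b x) - 1. cell_error r \<mu> (nodes a b x ! i) (nodes a b x ! Suc i))"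
  by (simp add: dual_distortion_def Let_def set_integral_cell_cost)

context interval_law
begin

lemma integrable_grid_cost: "integrable \<mu> (grid_cost r xs)"
  unfolding grid_cost_def[abs_def] by (intro Bochner_Integration.integrable_sum integrable_gap_cost)

lemma integral_grid_cost:
  "(LINT \<xi>|\<mu>. grid_cost r xs \<xi>) = (\<Sum>i<length xs - 1. cell_error r \<mu> (xs ! i) (xs ! Suc i))"
  unfolding grid_cost_def cell_error_def by (subst Bochner_Integration.integral_sum) (auto intro: integrable_gap_cost)

lemma dual_error_eq: "dual_error r \<mu> \<Gamma> = (LINT \<xi>|\<mu>. grid_cost r (sorted_list_of_set \<Gamma>) \<xi>)"
  by (simp add: dual_error_def Let_def set_integral_cell_cost integral_grid_cost)

lemma dual_distortion_eq: "dual_distortion r \<mu> a b x = (LINT \<xi>|\<mu>. grid_cost r (nodes a b x) \<xi>)"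
  by (simp add: dual_distortion_eq_cell_error integral_grid_cost)

text \<open>Lets a list with repeated nodes stand for its set: almost every \<xi> lies in (a, b) and
  off the nodes, where the pointwise costs agree.\<close>

lemma dual_error_set:
  assumes "sorted xs" "a \<in> set xs" "b \<in> set xs"
  shows "dual_error r \<mu> (set xs) = (LINT \<xi>|\<mu>. grid_cost r xs \<xi>)"
  unfolding dual_error_eq
proof (rule integral_cong_AE)
  show "AE \<xi> in \<mu>. grid_cost r (sorted_list_of_set (set xs)) \<xi> = grid_cost r xs \<xi>"
    using AE_notin[OF finite_set, of xs] AE_inside
  proof eventually_elim
    case (elim \<xi>)
    then show ?case using assms by (intro grid_cost_set_cong[of _ _ _ a b]) auto
  qed
qed (rule borel_measurable_integrable[OF integrable_grid_cost])+

end

section \<open>Vectors of free nodes, open and closed simplex\<close>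

lemma nodes_nth:
  fixes x :: "real ^ 'n::{finite,linorder}"
  shows "k < CARD('n) + 2 \<Longrightarrow> nodes a b x ! k =
    (if k = 0 then a else if k = CARD('n) + 1 then b else x $ (sorted_list_of_set UNIV ! (k - 1)))"
  by (auto simp: nodes_def nth_append nth_Cons')

lemma length_nodes: "length (nodes a b (x :: real ^ 'n::{finite,linorder})) = CARD('n) + 2"
  by (simp add: nodes_def)

lemma set_nodes: "set (nodes a b x) = {a, b} \<union> range (\<lambda>i. x $ i)"
  by (auto simp: nodes_def)

lemma sorted_nodes:
  assumes "mono (\<lambda>i. x $ i)" "\<And>i. a \<le> x $ i \<and> x $ i \<le> b" "a \<le> b"
  shows "sorted (nodes a b x)"
proof -
  have "sorted (map (\<lambda>i. x $ i) (sorted_list_of_set UNIV))"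
    unfolding sorted_map
    by (rule sorted_wrt_mono_rel[of _ "(\<le>)"]) (use assms(1) in \<open>auto simp: monoD\<close>)
  then show ?thesis using assms by (auto simp: nodes_def sorted_append)
qed

lemma strict_sorted_nodes:
  assumes "x \<in> ordered_simplex a b" "a < b"
  shows "sorted_wrt (<) (nodes a b x)"
proof -
  have "sorted_wrt (<) (map (\<lambda>i. x $ i) (sorted_list_of_set UNIV))"
    unfolding sorted_wrt_map
    by (rule sorted_wrt_mono_rel[of _ "(<)"]) (use assms(1) in \<open>auto simp: ordered_simplex_def strict_mono_def\<close>)
  then show ?thesis using assms by (auto simp: nodes_def sorted_wrt_append ordered_simplex_def)
qed

text \<open>The entries are assigned to the indices in increasing order, so sortedness of the list
  becomes monotonicity of the vector.\<close>

lemma vector_of_list: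
  assumes "length zs = CARD('n::{finite,linorder})"
  obtains x :: "real ^ 'n::{finite,linorder}" where "map (\<lambda>i. x $ i) (sorted_list_of_set UNIV) = zs"
    "range (\<lambda>i. x $ i) = set zs"
    "sorted zs \<Longrightarrow> mono (\<lambda>i. x $ i)" "sorted_wrt (<) zs \<Longrightarrow> strict_mono (\<lambda>i. x $ i)"
proof -
  define L where "L = sorted_list_of_set (UNIV :: 'n set)"
  have L: "length L = CARD('n)" "distinct L" "set L = UNIV" "sorted L"
    by (auto simp: L_def)
  define x :: "(real, 'n) vec" where "x = (\<chi> i. the (map_of (zip L zs) i))"
  have nth: "x $ (L ! p) = zs ! p" if "p < CARD('n)" for p
    using that L assms by (simp add: x_def map_of_zip_nth)
  have map: "map (\<lambda>i. x $ i) L = zs"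
    by (intro nth_equalityI) (use L assms nth in auto)
  have pos: "\<exists>p q. p < q \<and> q < CARD('n) \<and> L ! p = i \<and> L ! q = j" if "i < j" for i j
  proof -
    obtain p q where pq: "p < CARD('n)" "q < CARD('n)" "L ! p = i" "L ! q = j"
      using L by (metis UNIV_I in_set_conv_nth)
    have "p < q"
    proof (rule ccontr)
      assume "\<not> p < q"
      then have "L ! q \<le> L ! p" using pq L by (intro sorted_nth_mono) auto
      then show False using pq that by simp
    qed
    then show ?thesis using pq by blast
  qed
  show ?thesis
  proof
    show "map (\<lambda>i. x $ i) (sorted_list_of_set UNIV) = zs" using map by (simp add: L_def)
    show "range (\<lambda>i. x $ i) = set zs" using arg_cong[OF map, of set] L by simp
    assume zs: "sorted zs"
    have "x $ i \<le> x $ j" if "i < j" for i j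
      using pos[OF that] nth assms sorted_nth_mono[OF zs] by (metis less_imp_le order.strict_trans)
    then show "mono (\<lambda>i. x $ i)" by (intro monoI) (auto simp: le_less)
  next
    assume zs: "sorted_wrt (<) zs"
    have "x $ i < x $ j" if "i < j" for i j
      using pos[OF that] nth assms sorted_wrt_nth_less[OF zs] by (metis order.strict_trans)
    then show "strict_mono (\<lambda>i. x $ i)" by (intro strict_monoI)
  qed
qed

lemma open_ordered_simplex: "open (ordered_simplex a b :: (real ^ 'n::{finite,linorder}) set)"
proof -
  have "ordered_simplex a b =
     (\<Inter>i. {x :: (real, 'n) vec. a < x $ i}) \<inter> (\<Inter>i. {x. x $ i < b}) \<inter> (\<Inter>i. \<Inter>j\<in>{j. i < j}. {x. x $ i < x $ j})"
    by (auto simp: ordered_simplex_def strict_mono_def)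
  also have "open \<dots>"
    by (intro open_Int open_INT ballI open_Collect_less continuous_intros) auto
  finally show ?thesis .
qed

text \<open>The compact domain on which a minimizer is first found; its vectors may have coinciding
  coordinates or coordinates equal to \<open>a\<close> or \<open>b\<close>.\<close>

definition closed_simplex :: "real \<Rightarrow> real \<Rightarrow> (real ^ 'n::{finite,linorder}) set" where
  "closed_simplex a b = {x. (\<forall>i. x $ i \<in> {a..b}) \<and> mono (\<lambda>i. x $ i)}"

lemma compact_closed_simplex: "compact (closed_simplex a b :: (real ^ 'n::{finite,linorder}) set)"
proof -
  have eq: "closed_simplex a b =
     cbox (\<chi> i. a) (\<chi> i. b) \<inter> (\<Inter>i. \<Inter>j\<in>{j. i \<le> j}. {x :: (real, 'n) vec. x $ i \<le> x $ j})"
    by (auto simp: closed_simplex_def mono_def mem_box_cart)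
  show ?thesis
    unfolding eq by (intro compact_Int_closed compact_cbox closed_INT ballI closed_Collect_le continuous_intros)
qed

lemma ordered_simplex_subset_closed: "ordered_simplex a b \<subseteq> closed_simplex a b"
  by (auto simp: ordered_simplex_def closed_simplex_def less_imp_le strict_mono_mono)

lemma sorted_nodes_closed_simplex:
  "x \<in> closed_simplex a b \<Longrightarrow> a \<le> b \<Longrightarrow> sorted (nodes a b x)"
  by (intro sorted_nodes) (auto simp: closed_simplex_def)

lemma set_nodes_closed_simplex:
  "x \<in> closed_simplex a b \<Longrightarrow> a \<le> b \<Longrightarrow> set (nodes a b x) \<subseteq> {a..b}"
  by (auto simp: set_nodes closed_simplex_def)

text \<open>Each node depends affinely on the vector. The fixed ends \<open>a\<close> and
  \<open>b\<close> have derivative 0, so the derivatives of the nodes are the entries of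
  \<open>nodes 0 0 h\<close>.\<close>

lemma nodes_has_derivative:
  fixes x :: "real ^ 'n::{finite,linorder}"
  assumes "k < CARD('n) + 2"
  shows "((\<lambda>x :: (real, 'n) vec. nodes a b x ! k) has_derivative (\<lambda>h. nodes 0 0 h ! k)) F"
  unfolding nodes_nth[OF assms]
  by (cases "k = 0"; cases "k = CARD('n) + 1"; simp add: bounded_linear_imp_has_derivative bounded_linear_vec_nth)

section \<open>Shape of optimal grids\<close>

context interval_law
begin

text \<open>A hull containing the support points \<open>a\<close> and \<open>b\<close> does not come
  from points in an open half-line missing one of them. Conversely, the segment from
  \<open>p\<close> to \<open>q\<close> lies in the hull and contains [a, b].\<close>

lemma dual_grid_iff:
  "dual_grid \<mu> N \<Gamma> \<longleftrightarrow> finite \<Gamma> \<and> card \<Gamma> \<le> N \<and> (\<exists>p\<in>\<Gamma>. p \<le> a) \<and> (\<exists>q\<in>\<Gamma>. b \<le> q)"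
proof -
  have "(\<exists>p\<in>\<Gamma>. p \<le> a) \<and> (\<exists>q\<in>\<Gamma>. b \<le> q)" if "measure_support \<mu> \<subseteq> convex hull \<Gamma>"
  proof -
    have sub: "{a, b} \<subseteq> convex hull \<Gamma>" using that support_endpoints by blast
    have "\<not> \<Gamma> \<subseteq> {a<..}" using sub hull_minimal[of \<Gamma> "{a<..}" convex] by auto
    moreover have "\<not> \<Gamma> \<subseteq> {..<b}" using sub hull_minimal[of \<Gamma> "{..<b}" convex] by auto
    ultimately show ?thesis by (auto simp: subset_eq not_less)
  qed
  moreover have "measure_support \<mu> \<subseteq> convex hull \<Gamma>" if "p \<in> \<Gamma>" "p \<le> a" "q \<in> \<Gamma>" "b \<le> q" for p q
  proof -
    have "measure_support \<mu> \<subseteq> {a..b}"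
      using hull_subset[of "measure_support \<mu>" convex] hull by simp
    also have "\<dots> \<subseteq> closed_segment p q" using that ab by (simp add: closed_segment_eq_real_ivl)
    also have "\<dots> \<subseteq> convex hull \<Gamma>"
      unfolding segment_convex_hull using that by (intro hull_mono) auto
    finally show ?thesis .
  qed
  ultimately show ?thesis unfolding dual_grid_def by blast
qed

text \<open>Integrates the pointwise comparison. For strictness it is enough that \<open>z\<close>
  cuts the gap around \<xi> for all \<xi> in one interval of positive mass.\<close>

lemma grid_cost_le_dual_error:
  assumes "dual_grid \<mu> N \<Gamma>" "sorted xs" "a \<in> set xs" "b \<in> set xs" "\<Gamma> \<inter> {a<..<b} \<subseteq> set xs"
  shows "(LINT \<xi>|\<mu>. grid_cost r xs \<xi>) \<le> dual_error r \<mu> \<Gamma>"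
    and "\<lbrakk>z \<in> set xs; a \<le> c; c < d; d \<le> b; emeasure \<mu> {c<..<d} \<noteq> 0;
      \<And>\<xi> u. \<lbrakk>u \<in> \<Gamma>; c < \<xi>; \<xi> < d\<rbrakk> \<Longrightarrow> \<not> (z \<le> u \<and> u \<le> \<xi>) \<and> \<not> (\<xi> \<le> u \<and> u \<le> z)\<rbrakk> \<Longrightarrow>
      (LINT \<xi>|\<mu>. grid_cost r xs \<xi>) < dual_error r \<mu> \<Gamma>"
proof -
  let ?ys = "sorted_list_of_set \<Gamma>"
  obtain p q where pq: "p \<in> \<Gamma>" "p \<le> a" "q \<in> \<Gamma>" "b \<le> q" and fin: "finite \<Gamma>"
    using assms(1) by (auto simp: dual_grid_iff)
  have le: "grid_cost r xs \<xi> \<le> grid_cost r ?ys \<xi>"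
    if "\<xi> \<notin> set xs" "\<xi> \<notin> \<Gamma>" "a < \<xi> \<and> \<xi> < b" for \<xi>
    using that pq fin assms by (intro grid_cost_le(1)[OF r, of xs a b _ _ p q]) auto
  have AE: "AE \<xi> in \<mu>. \<xi> \<notin> set xs \<and> \<xi> \<notin> \<Gamma> \<and> a < \<xi> \<and> \<xi> < b"
    using AE_notin[OF finite_set, of xs] AE_notin[OF fin] AE_inside by eventually_elim auto
  have AE_le: "AE \<xi> in \<mu>. grid_cost r xs \<xi> \<le> grid_cost r ?ys \<xi>"
    using AE by eventually_elim (use le in auto)
  then show "(LINT \<xi>|\<mu>. grid_cost r xs \<xi>) \<le> dual_error r \<mu> \<Gamma>"
    unfolding dual_error_eq by (intro integral_mono_AE integrable_grid_cost)
  assume z: "z \<in> set xs" "a \<le> c" "c < d" "d \<le> b" "emeasure \<mu> {c<..<d} \<noteq> 0"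
    "\<And>\<xi> u. \<lbrakk>u \<in> \<Gamma>; c < \<xi>; \<xi> < d\<rbrakk> \<Longrightarrow> \<not> (z \<le> u \<and> u \<le> \<xi>) \<and> \<not> (\<xi> \<le> u \<and> u \<le> z)"
  show "(LINT \<xi>|\<mu>. grid_cost r xs \<xi>) < dual_error r \<mu> \<Gamma>"
    unfolding dual_error_eq
  proof (rule integral_less_AE[OF integrable_grid_cost integrable_grid_cost z(5)])
    show "AE \<xi> in \<mu>. \<xi> \<in> {c<..<d} \<longrightarrow> grid_cost r xs \<xi> \<noteq> grid_cost r ?ys \<xi>"
      using AE
    proof eventually_elim
      case (elim \<xi>)
      show ?case
      proof
        assume "\<xi> \<in> {c<..<d}"
        then have "grid_cost r xs \<xi> < grid_cost r ?ys \<xi>"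
          using elim pq fin assms z by (intro grid_cost_le(2)[OF r, of xs a b _ _ p q z]) auto
        then show "grid_cost r xs \<xi> \<noteq> grid_cost r ?ys \<xi>" by simp
      qed
    qed
  qed (use AE_le sets_mu in auto)
qed

text \<open>A dual grid has a point at or below \<open>a\<close> and a different one at or above
  \<open>b\<close>; replacing all outer points by \<open>a\<close> and \<open>b\<close> thus
  respects the level.\<close>

lemma card_inner_le:
  assumes "dual_grid \<mu> N \<Gamma>"
  shows "card (\<Gamma> \<inter> {a<..<b}) + 2 \<le> card \<Gamma>"
proof -
  obtain p q where pq: "p \<in> \<Gamma>" "p \<le> a" "q \<in> \<Gamma>" "b \<le> q" and fin: "finite \<Gamma>"
    using assms by (auto simp: dual_grid_iff)
  have "p \<noteq> q" using pq ab by auto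
  have "card (\<Gamma> \<inter> {a<..<b}) + card {p, q} = card (\<Gamma> \<inter> {a<..<b} \<union> {p, q})"
    using pq fin by (intro card_Un_disjoint[symmetric]) auto
  also have "\<dots> \<le> card \<Gamma>" using pq fin by (intro card_mono) auto
  finally show ?thesis using \<open>p \<noteq> q\<close> by simp
qed

lemma right_gap:
  assumes "finite \<Gamma>"
  obtains c where "a < c" "c \<le> b" "\<Gamma> \<inter> {a<..<c} = {}"
proof
  let ?A = "insert b {x \<in> \<Gamma>. a < x}"
  have A: "finite ?A" "?A \<noteq> {}" using assms by auto
  show "a < Min ?A" using Min_in[OF A] ab by auto
  show "Min ?A \<le> b" using A by auto
  show "\<Gamma> \<inter> {a<..<Min ?A} = {}" using A by auto
qed

lemma left_gap:
  assumes "finite \<Gamma>"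
  obtains d where "a \<le> d" "d < b" "\<Gamma> \<inter> {d<..<b} = {}"
proof
  let ?A = "insert a {x \<in> \<Gamma>. x < b}"
  have A: "finite ?A" "?A \<noteq> {}" using assms by auto
  show "Max ?A < b" using Max_in[OF A] ab by auto
  show "a \<le> Max ?A" using A by auto
  show "\<Gamma> \<inter> {Max ?A<..<b} = {}" using A by auto
qed

lemma optimal_grid_structure:
  assumes opt: "optimal_dual_grid r \<mu> N \<Gamma>"
  shows "\<Gamma> = {a, b} \<union> (\<Gamma> \<inter> {a<..<b})" "card \<Gamma> = N"
proof -
  define \<Gamma>0 where "\<Gamma>0 = {a, b} \<union> (\<Gamma> \<inter> {a<..<b})"
  have dg: "dual_grid \<mu> N \<Gamma>" and min: "\<And>\<Gamma>'. dual_grid \<mu> N \<Gamma>' \<Longrightarrow> dual_error r \<mu> \<Gamma> \<le> dual_error r \<mu> \<Gamma>'"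
    using opt by (auto simp: optimal_dual_grid_def)
  have fin: "finite \<Gamma>" and card: "card \<Gamma> \<le> N" using dg by (auto simp: dual_grid_iff)
  have fin0: "finite \<Gamma>0" using fin by (simp add: \<Gamma>0_def)
  have card0: "card \<Gamma>0 \<le> card \<Gamma>"
    using card_Un_le[of "{a, b}" "\<Gamma> \<inter> {a<..<b}"] card_inner_le[OF dg] ab by (simp add: \<Gamma>0_def)
  have dual: "dual_grid \<mu> N \<Gamma>'" if "\<Gamma>0 \<subseteq> \<Gamma>'" "finite \<Gamma>'" "card \<Gamma>' \<le> N" for \<Gamma>'
    using that by (auto simp: dual_grid_iff \<Gamma>0_def)
  have no_better: False
    if "\<Gamma>0 \<subseteq> \<Gamma>'" "finite \<Gamma>'" "card \<Gamma>' \<le> N" "z \<in> \<Gamma>'" "a \<le> c" "c < d" "d \<le> b" "emeasure \<mu> {c<..<d} \<noteq> 0"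
      "\<And>\<xi> u. \<lbrakk>u \<in> \<Gamma>; c < \<xi>; \<xi> < d\<rbrakk> \<Longrightarrow> \<not> (z \<le> u \<and> u \<le> \<xi>) \<and> \<not> (\<xi> \<le> u \<and> u \<le> z)" for \<Gamma>' z c d
  proof -
    have "dual_error r \<mu> \<Gamma>' < dual_error r \<mu> \<Gamma>"
      unfolding dual_error_eq[of \<Gamma>']
      by (rule grid_cost_le_dual_error(2)[OF dg, where z = z and c = c and d = d])
        (use that in \<open>auto simp: \<Gamma>0_def\<close>)
    then show False using min[OF dual[OF that(1-3)]] by simp
  qed
  obtain c where c: "a < c" "c \<le> b" "\<Gamma> \<inter> {a<..<c} = {}" using right_gap[OF fin] .
  obtain d where d: "a \<le> d" "d < b" "\<Gamma> \<inter> {d<..<b} = {}" using left_gap[OF fin] .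
  have eqN: "card \<Gamma>0 = N"
  proof (rule ccontr)
    assume "card \<Gamma>0 \<noteq> N"
    then have lt: "card \<Gamma>0 < N" using card0 card by simp
    \<comment> \<open>The extra point is placed next to \<open>a\<close>, where positive mass is
      guaranteed; elsewhere the support may have holes.\<close>
    define t where "t = (a + c) / 2"
    have t: "a < t" "t < c" using c by (auto simp: t_def)
    show False
    proof (rule no_better[of "insert t \<Gamma>0" t a t])
      show "card (insert t \<Gamma>0) \<le> N" using lt fin0 card_insert_le_m1[of N \<Gamma>0 t] by (simp add: card_insert_if)
      show "\<not> (t \<le> u \<and> u \<le> \<xi>) \<and> \<not> (\<xi> \<le> u \<and> u \<le> t)" if "u \<in> \<Gamma>" "a < \<xi>" "\<xi> < t" for \<xi> u
        using that t c(3) by force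
    qed (use t c fin0 pos_left in auto)
  qed
  then show "card \<Gamma> = N" using card0 card by simp
  have "a \<in> \<Gamma>"
  proof (rule ccontr)
    \<comment> \<open>Here \<Gamma> has no point between \<open>a\<close> and any \<xi> in (a, c),
      so the node \<open>a\<close> of \<Gamma>0 shortens the gap around each such \<xi>.\<close>
    assume na: "a \<notin> \<Gamma>"
    show False
    proof (rule no_better[of \<Gamma>0 a a c])
      show "\<not> (a \<le> u \<and> u \<le> \<xi>) \<and> \<not> (\<xi> \<le> u \<and> u \<le> a)" if "u \<in> \<Gamma>" "a < \<xi>" "\<xi> < c" for \<xi> u
        using that na c(3) by (cases "u = a") force+
    qed (use c fin0 pos_left eqN in \<open>auto simp: \<Gamma>0_def\<close>)
  qed
  moreover have "b \<in> \<Gamma>"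
  proof (rule ccontr)
    assume nb: "b \<notin> \<Gamma>"
    show False
    proof (rule no_better[of \<Gamma>0 b d b])
      show "\<not> (b \<le> u \<and> u \<le> \<xi>) \<and> \<not> (\<xi> \<le> u \<and> u \<le> b)" if "u \<in> \<Gamma>" "d < \<xi>" "\<xi> < b" for \<xi> u
        using that nb d(3) by (cases "u = b") force+
    qed (use d fin0 pos_right eqN in \<open>auto simp: \<Gamma>0_def\<close>)
  qed
  ultimately have "\<Gamma>0 \<subseteq> \<Gamma>" by (auto simp: \<Gamma>0_def)
  then have "\<Gamma>0 = \<Gamma>" using eqN card card0 fin by (intro card_subset_eq) auto
  then show "\<Gamma> = {a, b} \<union> (\<Gamma> \<inter> {a<..<b})" by (simp add: \<Gamma>0_def)
qed

lemma optimal_grid_eq_nodes: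
  assumes opt: "optimal_dual_grid r \<mu> N \<Gamma>" and N: "N = CARD('n::{finite,linorder}) + 2"
  obtains x :: "real ^ 'n::{finite,linorder}" where "x \<in> ordered_simplex a b" "\<Gamma> = set (nodes a b x)"
proof -
  have fin: "finite \<Gamma>" using opt by (auto simp: optimal_dual_grid_def dual_grid_def)
  define zs where "zs = sorted_list_of_set (\<Gamma> \<inter> {a<..<b})"
  have "card ({a, b} \<union> (\<Gamma> \<inter> {a<..<b})) = card {a, b} + card (\<Gamma> \<inter> {a<..<b})"
    using fin by (intro card_Un_disjoint) auto
  then have "card \<Gamma> = card {a, b} + card (\<Gamma> \<inter> {a<..<b})"
    unfolding optimal_grid_structure(1)[OF opt, symmetric] .
  then have len: "length zs = CARD('n)"
    using optimal_grid_structure(2)[OF opt] N ab unfolding zs_def by simp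
  obtain x :: "(real, 'n) vec" where x: "range (\<lambda>i. x $ i) = set zs" "sorted_wrt (<) zs \<Longrightarrow> strict_mono (\<lambda>i. x $ i)"
    using vector_of_list[OF len] by metis
  have set: "set zs = \<Gamma> \<inter> {a<..<b}" using fin by (simp add: zs_def)
  have "x \<in> ordered_simplex a b"
    using x set by (auto simp: ordered_simplex_def zs_def)
  moreover have "\<Gamma> = set (nodes a b x)"
    unfolding set_nodes x(1) set by (rule optimal_grid_structure(1)[OF opt])
  ultimately show ?thesis by (rule that)
qed

end

section \<open>Slopes of the cell error and translation under log-concavity\<close>

text \<open>The negative of the partial derivative of \<open>cell_error\<close> in the left end;
  \<open>right_slope\<close> is the one in the right end. Both are nonnegative when
  \<open>r \<ge> 1\<close>.\<close>

definition left_slope :: "real \<Rightarrow> real measure \<Rightarrow> real \<Rightarrow> real \<Rightarrow> real" where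
  "left_slope r \<mu> u v = (LINT \<xi>|\<mu>. gap_slope r (\<xi> - u) (v - \<xi>))"

definition right_slope :: "real \<Rightarrow> real measure \<Rightarrow> real \<Rightarrow> real \<Rightarrow> real" where
  "right_slope r \<mu> u v = (LINT \<xi>|\<mu>. gap_slope r (v - \<xi>) (\<xi> - u))"

text \<open>The points \<open>s + \<delta>\<close> and \<open>t\<close> are convex combinations of
  \<open>s\<close> and \<open>t + \<delta>\<close> with interchanged weights, so adding the two
  concavity inequalities removes the weights. In other words, the ratio
  \<open>f (\<xi> + \<delta>) / f \<xi>\<close> decreases in \<xi>.\<close>

lemma log_concave_shift:
  fixes f :: "real \<Rightarrow> real"
  assumes "concave_on {a<..<b} (\<lambda>\<xi>. ln (f \<xi>))" and pos: "\<And>\<xi>. a < \<xi> \<Longrightarrow> \<xi> < b \<Longrightarrow> f \<xi> > 0"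
    and st: "a < s" "s \<le> t" "0 < \<delta>" "t + \<delta> < b"
  shows "f s * f (t + \<delta>) \<le> f (s + \<delta>) * f t"
proof -
  define D where "D = t + \<delta> - s"
  have D: "D > 0" using st by (simp add: D_def)
  have conc: "(1 - \<theta>) * ln (f s) + \<theta> * ln (f (t + \<delta>)) \<le> ln (f ((1 - \<theta>) * s + \<theta> * (t + \<delta>)))"
    if "0 \<le> \<theta>" "\<theta> \<le> 1" for \<theta>
    using concave_onD[OF assms(1) that, of s "t + \<delta>"] st by simp
  have comb: "(1 - \<theta>) * s + \<theta> * (t + \<delta>) = s + \<theta> * D" for \<theta>
    by (simp add: D_def algebra_simps)
  have le1: "0 \<le> \<delta> / D" "\<delta> / D \<le> 1" using D st by (auto simp: D_def)
  have "s + \<delta> / D * D = s + \<delta>" "s + (1 - \<delta> / D) * D = t"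
    using D by (simp_all add: left_diff_distrib) (simp add: D_def)
  then have 1: "(1 - \<delta> / D) * ln (f s) + \<delta> / D * ln (f (t + \<delta>)) \<le> ln (f (s + \<delta>))"
    and 2: "(1 - (1 - \<delta> / D)) * ln (f s) + (1 - \<delta> / D) * ln (f (t + \<delta>)) \<le> ln (f t)"
    using conc[of "\<delta> / D"] conc[of "1 - \<delta> / D"] le1 unfolding comb by auto
  have "ln (f s) + ln (f (t + \<delta>)) \<le> ln (f (s + \<delta>)) + ln (f t)"
    using 1 2 by (simp add: algebra_simps)
  moreover have p: "0 < f s" "0 < f t" "0 < f (s + \<delta>)" "0 < f (t + \<delta>)"
    using st by (auto intro!: pos)
  ultimately have "ln (f s * f (t + \<delta>)) \<le> ln (f (s + \<delta>) * f t)"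
    by (simp add: ln_mult_pos)
  then show ?thesis using p by (subst (asm) ln_le_cancel_iff) auto
qed

section \<open>Gradient of the distortion, existence and criticality of optimal grids\<close>

context interval_law
begin

text \<open>The chain rule is applied to each cell. On the boundary of the simplex the result serves
  for continuity, in the interior for the gradient.\<close>

lemma dual_distortion_has_derivative:
  fixes x :: "real ^ 'n::{finite,linorder}"
  assumes x: "x \<in> closed_simplex a b"
  defines "xs \<equiv> nodes a b x"
  shows "(dual_distortion r \<mu> a b has_derivative
    (\<lambda>h. \<Sum>i<CARD('n) + 1. right_slope r \<mu> (xs ! i) (xs ! Suc i) * nodes 0 0 h ! Suc i
      - left_slope r \<mu> (xs ! i) (xs ! Suc i) * nodes 0 0 h ! i)) (at x)"
proof -
  have "((\<lambda>y. cell_error r \<mu> (nodes a b y ! i) (nodes a b y ! Suc i)) has_derivative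
    (\<lambda>h. right_slope r \<mu> (xs ! i) (xs ! Suc i) * nodes 0 0 h ! Suc i
      - left_slope r \<mu> (xs ! i) (xs ! Suc i) * nodes 0 0 h ! i)) (at x)" if i: "i < CARD('n) + 1" for i
  proof -
    have "xs ! i \<in> {a..b}" "xs ! Suc i \<in> {a..b}"
      using set_nodes_closed_simplex[OF x] ab i nth_mem[of i xs] nth_mem[of "Suc i" xs]
      by (auto simp: xs_def length_nodes subset_eq)
    note cell = cell_error_has_derivative[OF this]
    have "((\<lambda>y :: (real, 'n) vec. (nodes a b y ! i, nodes a b y ! Suc i)) has_derivative
       (\<lambda>h. (nodes 0 0 h ! i, nodes 0 0 h ! Suc i))) (at x)"
      using i by (intro has_derivative_Pair nodes_has_derivative) auto
    from has_derivative_compose[OF this cell[unfolded xs_def]]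
    show ?thesis by (simp add: xs_def left_slope_def right_slope_def)
  qed
  moreover have "length (nodes a b y) - 1 = CARD('n) + 1" for y :: "(real, 'n) vec"
    by (simp add: length_nodes)
  ultimately show ?thesis
    unfolding dual_distortion_eq_cell_error[abs_def]
    by (simp only:) (intro has_derivative_sum; simp only: lessThan_iff)
qed

text \<open>The distortion attains its minimum over the closed simplex, and every dual grid is
  matched there by a vector whose nodes include its points in (a, b), hence with no larger
  error.\<close>

lemma optimal_grid_exists:
  assumes N: "N = CARD('n::{finite,linorder}) + 2"
  obtains \<Gamma> where "optimal_dual_grid r \<mu> N \<Gamma>"
proof -
  let ?D = "closed_simplex a b :: (real, 'n) vec set"
  have "continuous_on ?D (dual_distortion r \<mu> a b)"
    using dual_distortion_has_derivative
    by (intro continuous_at_imp_continuous_on ballI) (blast intro: has_derivative_continuous)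
  moreover have "(\<chi> i. a) \<in> ?D" using ab by (auto simp: closed_simplex_def mono_def)
  ultimately obtain z where z: "z \<in> ?D" "\<And>y. y \<in> ?D \<Longrightarrow> dual_distortion r \<mu> a b z \<le> dual_distortion r \<mu> a b y"
    using continuous_attains_inf[OF compact_closed_simplex] by blast
  have "dual_distortion r \<mu> a b z \<le> dual_error r \<mu> \<Gamma>" if dg: "dual_grid \<mu> N \<Gamma>" for \<Gamma>
  proof -
    have fin: "finite \<Gamma>" using dg by (simp add: dual_grid_iff)
    let ?I = "\<Gamma> \<inter> {a<..<b}"
    \<comment> \<open>Copies of \<open>b\<close> fill the missing coordinates: the list stays sorted
      and gains no node besides the end \<open>b\<close>.\<close>
    define zs where "zs = sorted_list_of_set ?I @ replicate (CARD('n) - card ?I) b"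
    have "card ?I \<le> CARD('n)"
      using card_inner_le[OF dg] dg N by (simp add: dual_grid_iff)
    then have len: "length zs = CARD('n)" by (simp add: zs_def)
    have "sorted zs" using fin by (auto simp: zs_def sorted_append)
    obtain y :: "(real, 'n) vec" where y: "range (\<lambda>i. y $ i) = set zs" "mono (\<lambda>i. y $ i)"
      using vector_of_list[OF len] \<open>sorted zs\<close> by metis
    have sub: "?I \<subseteq> set zs" "set zs \<subseteq> {a..b}"
      using fin ab by (auto simp: zs_def)
    have "y $ i \<in> {a..b}" for i using y(1) sub(2) by blast
    then have "y \<in> ?D" using y(2) by (simp add: closed_simplex_def)
    then have "dual_distortion r \<mu> a b z \<le> (LINT \<xi>|\<mu>. grid_cost r (nodes a b y) \<xi>)"
      using z(2) by (simp add: dual_distortion_eq)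
    also have "\<dots> \<le> dual_error r \<mu> \<Gamma>"
      using sub y(1) \<open>y \<in> ?D\<close> ab
      by (intro grid_cost_le_dual_error(1)[OF dg] sorted_nodes_closed_simplex) (auto simp: set_nodes)
    finally show ?thesis .
  qed
  moreover have "dual_error r \<mu> (set (nodes a b z)) = dual_distortion r \<mu> a b z"
    unfolding dual_distortion_eq
    by (intro dual_error_set sorted_nodes_closed_simplex) (use z ab in \<open>auto simp: set_nodes\<close>)
  \<comment> \<open>The minimizer may have repeated nodes, which only lowers the cardinality of its
    grid.\<close>
  moreover have "dual_grid \<mu> N (set (nodes a b z))"
    using card_length[of "nodes a b z"] N by (auto simp: dual_grid_iff set_nodes length_nodes)
  ultimately have "optimal_dual_grid r \<mu> N (set (nodes a b z))"
    by (simp add: optimal_dual_grid_def)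
  then show ?thesis by (rule that)
qed

text \<open>The vector of an optimal grid minimizes the distortion over the open simplex, so its
  derivative there is the zero map.\<close>

lemma optimal_grid_critical:
  assumes opt: "optimal_dual_grid r \<mu> N \<Gamma>" and N: "N = CARD('n::{finite,linorder}) + 2"
  obtains x :: "real ^ 'n::{finite,linorder}" where "critical_point r \<mu> a b x" "\<Gamma> = set (nodes a b x)"
proof -
  obtain x :: "(real, 'n) vec" where x: "x \<in> ordered_simplex a b" "\<Gamma> = set (nodes a b x)"
    using optimal_grid_eq_nodes[OF opt N] .
  have eq: "dual_error r \<mu> (set (nodes a b y)) = dual_distortion r \<mu> a b y"
    if "y \<in> ordered_simplex a b" for y :: "(real, 'n) vec"
    unfolding dual_distortion_eq using that ordered_simplex_subset_closed[of a b] ab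
    by (intro dual_error_set sorted_nodes_closed_simplex) (auto simp: set_nodes)
  have min: "\<forall>y \<in> (ordered_simplex a b :: (real, 'n) vec set). dual_distortion r \<mu> a b x \<le> dual_distortion r \<mu> a b y"
  proof
    fix y :: "(real, 'n) vec" assume y: "y \<in> ordered_simplex a b"
    have "dual_grid \<mu> N (set (nodes a b y))"
      using card_length[of "nodes a b y"] N by (auto simp: dual_grid_iff set_nodes length_nodes)
    then show "dual_distortion r \<mu> a b x \<le> dual_distortion r \<mu> a b y"
      using opt x y eq[OF x(1)] eq[OF y] by (auto simp: optimal_dual_grid_def)
  qed
  have "x \<in> closed_simplex a b" using x ordered_simplex_subset_closed by blast
  note der = dual_distortion_has_derivative[OF this]
  have "GDERIV (dual_distortion r \<mu> a b) x :> 0"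
    using der unfolding differential_zero_maxmin[OF x(1) open_ordered_simplex der disjI2[OF min]]
    by (simp add: gderiv_def)
  then show ?thesis using x by (intro that) (auto simp: critical_point_def)
qed

lemma critical_point_balance:
  fixes x :: "real ^ 'n::{finite,linorder}"
  assumes crit: "critical_point r \<mu> a b x" and m: "0 < m" "m < CARD('n) + 1"
  defines "xs \<equiv> nodes a b x"
  shows "right_slope r \<mu> (xs ! (m - 1)) (xs ! m) = left_slope r \<mu> (xs ! m) (xs ! Suc m)"
proof -
  have x: "x \<in> closed_simplex a b" and der0: "(dual_distortion r \<mu> a b has_derivative (\<lambda>h. 0)) (at x)"
    using crit ordered_simplex_subset_closed[of a b] by (auto simp: critical_point_def gderiv_def)
  define L where "L = sorted_list_of_set (UNIV :: 'n set)"
  have L: "length L = CARD('n)" "distinct L" by (auto simp: L_def)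
  \<comment> \<open>Position 0 of the node list is the fixed end \<open>a\<close>, so node
    \<open>m\<close> is the coordinate at index position \<open>m - 1\<close>. The direction
    \<open>h\<close> moves this node alone.\<close>
  define h :: "(real, 'n) vec" where "h = axis (L ! (m - 1)) 1"
  have h: "nodes 0 0 h ! i = (if i = m then 1 else 0)" if "i < CARD('n) + 2" for i
  proof (cases "i = 0 \<or> i = CARD('n) + 1")
    case True
    then show ?thesis using m nodes_nth[OF that, of 0 0 h] by auto
  next
    case False
    have "i - 1 < length L" "m - 1 < length L" using False m that L by auto
    then have "L ! (i - 1) = L ! (m - 1) \<longleftrightarrow> i - 1 = m - 1"
      using L by (intro nth_eq_iff_index_eq)
    also have "\<dots> \<longleftrightarrow> i = m" using False m by auto
    finally have "L ! (i - 1) = L ! (m - 1) \<longleftrightarrow> i = m" .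
    then show ?thesis
      using False nodes_nth[OF that, of 0 0 h] by (simp add: L_def[symmetric] h_def axis_def)
  qed
  let ?S = "\<lambda>i. right_slope r \<mu> (xs ! i) (xs ! Suc i)" and ?T = "\<lambda>i. left_slope r \<mu> (xs ! i) (xs ! Suc i)"
  have "(\<Sum>i<CARD('n) + 1. ?S i * nodes 0 0 h ! Suc i - ?T i * nodes 0 0 h ! i) = 0"
    using fun_cong[OF has_derivative_unique[OF dual_distortion_has_derivative[OF x] der0], of h]
    by (simp add: xs_def)
  \<comment> \<open>Node \<open>m\<close> is the right end of cell \<open>m - 1\<close> and the left
    end of cell \<open>m\<close>; all other cells stay fixed.\<close>
  also have "(\<Sum>i<CARD('n) + 1. ?S i * nodes 0 0 h ! Suc i - ?T i * nodes 0 0 h ! i) =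
    (\<Sum>i<CARD('n) + 1. (if i = m - 1 then ?S i else 0)) - (\<Sum>i<CARD('n) + 1. (if i = m then ?T i else 0))"
    unfolding sum_subtractf[symmetric] using m by (intro sum.cong) (auto simp: h)
  also have "\<dots> = ?S (m - 1) - ?T m" using m by (cases m) (simp_all del: sum.lessThan_Suc)
  finally show ?thesis using m by simp
qed

end

section \<open>Monotonicity of the slopes in the opposite end\<close>

context interval_law
begin

text \<open>The integrand increases strictly on all of (u, v'), including the part beyond
  \<open>v\<close>, where it rises from 0.\<close>

lemma left_slope_strict_mono:
  assumes "v < v'" "u < v'" "emeasure \<mu> {u<..<v'} \<noteq> 0"
  shows "left_slope r \<mu> u v < left_slope r \<mu> u v'"
  unfolding left_slope_def
proof (rule integral_less_AE[OF integrable_gap_slope(1) integrable_gap_slope(1) assms(3)])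
  show "AE \<xi> in \<mu>. \<xi> \<in> {u<..<v'} \<longrightarrow> gap_slope r (\<xi> - u) (v - \<xi>) \<noteq> gap_slope r (\<xi> - u) (v' - \<xi>)"
  proof (intro AE_I2 impI)
    fix \<xi> assume "\<xi> \<in> {u<..<v'}"
    then have "gap_slope r (\<xi> - u) (v - \<xi>) < gap_slope r (\<xi> - u) (v' - \<xi>)"
      using assms r by (intro gap_slope_strict_mono) auto
    then show "gap_slope r (\<xi> - u) (v - \<xi>) \<noteq> gap_slope r (\<xi> - u) (v' - \<xi>)" by simp
  qed
  show "AE \<xi> in \<mu>. gap_slope r (\<xi> - u) (v - \<xi>) \<le> gap_slope r (\<xi> - u) (v' - \<xi>)"
    using assms r by (intro AE_I2 gap_slope_mono) auto
qed (simp add: sets_mu)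

lemma right_slope_antimono:
  assumes "u' \<le> u"
  shows "right_slope r \<mu> u v \<le> right_slope r \<mu> u' v"
  unfolding right_slope_def
  using assms r by (intro integral_mono integrable_gap_slope gap_slope_mono) auto

end

section \<open>Uniqueness of the critical point for log-concave densities\<close>

locale log_concave_law = interval_law +
  fixes f :: "real \<Rightarrow> real"
  assumes f_measurable [measurable]: "f \<in> borel_measurable borel"
    and mu_eq: "\<mu> = density lborel (\<lambda>\<xi>. ennreal (f \<xi>))"
    and f_pos: "a < \<xi> \<Longrightarrow> \<xi> < b \<Longrightarrow> f \<xi> > 0"
    and f_zero: "\<xi> \<notin> {a<..<b} \<Longrightarrow> f \<xi> = 0"
    and f_log_concave: "concave_on {a<..<b} (\<lambda>\<xi>. ln (f \<xi>))"
begin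

lemma f_nonneg: "f \<xi> \<ge> 0"
  using f_pos[of \<xi>] f_zero[of \<xi>] by (cases "a < \<xi> \<and> \<xi> < b") (auto intro: less_imp_le)

lemma integral_mu:
  assumes [measurable]: "g \<in> borel_measurable borel"
  shows "(LINT \<xi>|\<mu>. g \<xi>) = (LINT \<xi>|lborel. f \<xi> * g \<xi>)"
  unfolding mu_eq using f_nonneg by (subst integral_density) auto

lemma integrable_mu:
  assumes [measurable]: "g \<in> borel_measurable borel"
  shows "integrable \<mu> g \<longleftrightarrow> integrable lborel (\<lambda>\<xi>. f \<xi> * g \<xi>)"
  unfolding mu_eq using f_nonneg by (subst integrable_density) auto

lemma pos_interval:
  assumes "a \<le> s" "s < t" "t \<le> b"
  shows "emeasure \<mu> {s<..<t} \<noteq> 0"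
proof
  assume "emeasure \<mu> {s<..<t} = 0"
  then have "AE \<xi> in \<mu>. \<xi> \<notin> {s<..<t}" by (intro AE_I[of _ _ "{s<..<t}"]) (auto simp: sets_mu)
  then have "AE \<xi> in lborel. 0 < ennreal (f \<xi>) \<longrightarrow> \<xi> \<notin> {s<..<t}"
    unfolding mu_eq by (subst (asm) AE_density) auto
  then have "AE \<xi> in lborel. \<xi> \<notin> {s<..<t}"
    by eventually_elim (use f_pos assms in auto)
  then have "emeasure lborel {s<..<t} = 0"
    by (subst (asm) AE_iff_measurable[OF _ refl]) (auto simp: greaterThanLessThan_def Int_def)
  then show False using assms by simp
qed

text \<open>Translating a cell together with \<xi> leaves \<open>gap_slope\<close> unchanged, so
  only the densities have to be compared: the factor gained by shifting \<xi> is at least the factor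
  gained by shifting the larger point \<open>p\<close>. Cross-multiplication replaces the quotient
  of densities.\<close>

lemma right_slope_shift:
  assumes "a \<le> u" "u < p" "p + \<delta> < b" "\<delta> > 0"
  shows "f (p + \<delta>) * right_slope r \<mu> u p \<le> f p * right_slope r \<mu> (u + \<delta>) (p + \<delta>)"
proof -
  let ?g = "\<lambda>\<xi>. gap_slope r (p - \<xi>) (\<xi> - u)"
  let ?h = "\<lambda>\<xi>. gap_slope r (p + \<delta> - \<xi>) (\<xi> - (u + \<delta>))"
  have int: "integrable lborel (\<lambda>\<xi>. f \<xi> * ?g \<xi>)" "integrable lborel (\<lambda>\<xi>. f \<xi> * ?h \<xi>)"
    using integrable_gap_slope(2) by (simp_all flip: integrable_mu)
  \<comment> \<open>The form \<open>\<delta> + 1 * \<xi>\<close> matches the affine change of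
    variables for Lebesgue measure.\<close>
  have gh: "?h (\<delta> + 1 * \<xi>) = ?g \<xi>" for \<xi> by (simp add: algebra_simps)
  have int': "integrable lborel (\<lambda>\<xi>. f (\<delta> + 1 * \<xi>) * ?g \<xi>)"
    using lborel_integrable_real_affine[OF int(2), of 1 \<delta>] unfolding gh by simp
  have "f (p + \<delta>) * right_slope r \<mu> u p = (LINT \<xi>|lborel. f (p + \<delta>) * (f \<xi> * ?g \<xi>))"
    unfolding right_slope_def by (subst integral_mu) simp_all
  also have "\<dots> \<le> (LINT \<xi>|lborel. f p * (f (\<delta> + 1 * \<xi>) * ?g \<xi>))"
  proof (intro integral_mono integrable_mult_right int int')
    fix \<xi>
    have "f (p + \<delta>) * f \<xi> \<le> f p * f (\<delta> + 1 * \<xi>)" if "u < \<xi>" "\<xi> < p"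
      using log_concave_shift[OF f_log_concave f_pos, of \<xi> p \<delta>] assms that by (simp add: mult_ac add_ac)
    moreover have "?g \<xi> = 0" if "\<not> (u < \<xi> \<and> \<xi> < p)"
      using that by (auto simp: gap_slope_def)
    ultimately show "f (p + \<delta>) * (f \<xi> * ?g \<xi>) \<le> f p * (f (\<delta> + 1 * \<xi>) * ?g \<xi>)"
      using gap_slope_nonneg[OF r, of "p - \<xi>" "\<xi> - u"]
      by (cases "u < \<xi> \<and> \<xi> < p") (auto simp: mult.assoc[symmetric] intro: mult_right_mono)
  qed
  also have "\<dots> = f p * right_slope r \<mu> (u + \<delta>) (p + \<delta>)"
    unfolding right_slope_def using lborel_integral_real_affine[of 1 "\<lambda>\<xi>. f \<xi> * ?h \<xi>" \<delta>]
    unfolding gh by (subst integral_mu) simp_all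
  finally show ?thesis .
qed

text \<open>Here \<open>p\<close> is the smaller point of each pair, so the comparison of densities
  is reversed.\<close>

lemma left_slope_shift:
  assumes "a < p" "p < v" "p + \<delta> < b" "\<delta> > 0"
  shows "f p * left_slope r \<mu> (p + \<delta>) (v + \<delta>) \<le> f (p + \<delta>) * left_slope r \<mu> p v"
proof -
  let ?g = "\<lambda>\<xi>. gap_slope r (\<xi> - p) (v - \<xi>)"
  let ?h = "\<lambda>\<xi>. gap_slope r (\<xi> - (p + \<delta>)) (v + \<delta> - \<xi>)"
  have int: "integrable lborel (\<lambda>\<xi>. f \<xi> * ?g \<xi>)" "integrable lborel (\<lambda>\<xi>. f \<xi> * ?h \<xi>)"
    using integrable_gap_slope(1) by (simp_all flip: integrable_mu)
  have gh: "?h (\<delta> + 1 * \<xi>) = ?g \<xi>" for \<xi> by (simp add: algebra_simps)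
  have int': "integrable lborel (\<lambda>\<xi>. f (\<delta> + 1 * \<xi>) * ?g \<xi>)"
    using lborel_integrable_real_affine[OF int(2), of 1 \<delta>] unfolding gh by simp
  have "f p * left_slope r \<mu> (p + \<delta>) (v + \<delta>) = (LINT \<xi>|lborel. f p * (f (\<delta> + 1 * \<xi>) * ?g \<xi>))"
    unfolding left_slope_def using lborel_integral_real_affine[of 1 "\<lambda>\<xi>. f \<xi> * ?h \<xi>" \<delta>]
    unfolding gh by (subst integral_mu) simp_all
  also have "\<dots> \<le> (LINT \<xi>|lborel. f (p + \<delta>) * (f \<xi> * ?g \<xi>))"
  proof (intro integral_mono integrable_mult_right int int')
    fix \<xi>
    have "f p * f (\<delta> + 1 * \<xi>) \<le> f (p + \<delta>) * f \<xi>" if "p < \<xi>" "\<xi> < v"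
    proof (cases "\<xi> + \<delta> < b")
      case True
      then show ?thesis
        using log_concave_shift[OF f_log_concave f_pos, of p \<xi> \<delta>] assms that by (simp add: mult_ac add_ac)
    next
      \<comment> \<open>The shifted cell may reach beyond \<open>b\<close>, where the density
        vanishes and the inequality is trivial.\<close>
      case False
      then have "f (\<delta> + 1 * \<xi>) = 0" by (intro f_zero) auto
      then show ?thesis using f_nonneg by simp
    qed
    moreover have "?g \<xi> = 0" if "\<not> (p < \<xi> \<and> \<xi> < v)"
      using that by (auto simp: gap_slope_def)
    ultimately show "f p * (f (\<delta> + 1 * \<xi>) * ?g \<xi>) \<le> f (p + \<delta>) * (f \<xi> * ?g \<xi>)"
      using gap_slope_nonneg[OF r, of "\<xi> - p" "v - \<xi>"]
      by (cases "p < \<xi> \<and> \<xi> < v") (auto simp: mult.assoc[symmetric] intro: mult_right_mono)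
  qed
  also have "\<dots> = f (p + \<delta>) * left_slope r \<mu> p v"
    unfolding left_slope_def by (subst integral_mu) simp_all
  finally show ?thesis .
qed

text \<open>Suppose a balanced node moves right by \<delta>, its left neighbour by at most \<delta>
  and its right neighbour by less than \<delta>. Then the pull from the left grows by at least the
  factor \<open>f (p + \<delta>) / f p\<close> and the pull from the right by strictly less, so
  balance is lost.\<close>

lemma balance_comparison:
  assumes "a \<le> u" "u < p" "p < v" "p + \<delta> < v'" "v' \<le> b" "\<delta> > 0"
    and le: "u' \<le> u + \<delta>" and less: "v' < v + \<delta>"
    and bal: "right_slope r \<mu> u p = left_slope r \<mu> p v"
    and bal': "right_slope r \<mu> u' (p + \<delta>) = left_slope r \<mu> (p + \<delta>) v'"
  shows False
proof -
  have "f p > 0" using assms by (intro f_pos) auto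
  have "f p * left_slope r \<mu> (p + \<delta>) (v + \<delta>) \<le> f (p + \<delta>) * left_slope r \<mu> p v"
    using assms by (intro left_slope_shift) auto
  also have "\<dots> = f (p + \<delta>) * right_slope r \<mu> u p" by (simp add: bal)
  also have "\<dots> \<le> f p * right_slope r \<mu> (u + \<delta>) (p + \<delta>)"
    using assms by (intro right_slope_shift) auto
  also have "\<dots> \<le> f p * right_slope r \<mu> u' (p + \<delta>)"
    using \<open>f p > 0\<close> by (intro mult_left_mono right_slope_antimono le) auto
  finally have "left_slope r \<mu> (p + \<delta>) (v + \<delta>) \<le> left_slope r \<mu> (p + \<delta>) v'"
    using \<open>f p > 0\<close> by (simp add: bal')
  \<comment> \<open>As \<open>v + \<delta>\<close> may exceed \<open>b\<close>, positivity is taken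
    from the smaller interval ending at \<open>v'\<close>, which lies in [a, b].\<close>
  moreover have "emeasure \<mu> {p + \<delta><..<v + \<delta>} \<noteq> 0"
  proof -
    have "emeasure \<mu> {p + \<delta><..<v'} \<le> emeasure \<mu> {p + \<delta><..<v + \<delta>}"
      using less by (intro emeasure_mono) (auto simp: sets_mu)
    then show ?thesis using pos_interval[of "p + \<delta>" v'] assms by auto
  qed
  ultimately show False
    using left_slope_strict_mono[of v' "v + \<delta>" "p + \<delta>"] less \<open>p < v\<close> by auto
qed

text \<open>Maximum principle: the comparison is made at the last index where the difference of the two
  vectors is largest, so that the right neighbours differ by strictly less.\<close>

lemma critical_point_le:
  fixes x y :: "real ^ 'n::{finite,linorder}"
  assumes x: "critical_point r \<mu> a b x" and y: "critical_point r \<mu> a b y" and k: "k < CARD('n) + 2"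
  shows "nodes a b y ! k \<le> nodes a b x ! k"
proof (rule ccontr)
  assume not_le: "\<not> nodes a b y ! k \<le> nodes a b x ! k"
  define X where "X = nodes a b x"
  define Y where "Y = nodes a b y"
  let ?n = "CARD('n)"
  let ?d = "\<lambda>k. Y ! k - X ! k"
  define \<delta> where "\<delta> = Max (?d ` {..<?n + 2})"
  have d_le: "?d i \<le> \<delta>" if "i < ?n + 2" for i
    unfolding \<delta>_def using that by (intro Max_ge) auto
  have "\<delta> > 0" using d_le[OF k] not_le by (auto simp: X_def Y_def)
  have "\<delta> \<in> ?d ` {..<?n + 2}" unfolding \<delta>_def by (intro Max_in) auto
  then obtain k0 where k0: "k0 < ?n + 2" "?d k0 = \<delta>" by auto
  let ?J = "{i. i < ?n + 2 \<and> ?d i = \<delta>}"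
  define m where "m = Max ?J"
  have J: "finite ?J" "?J \<noteq> {}" using k0 by auto
  have m: "m < ?n + 2" "?d m = \<delta>" using Max_in[OF J] by (auto simp: m_def)
  have ends: "X ! 0 = a" "Y ! 0 = a" "X ! (?n + 1) = b" "Y ! (?n + 1) = b"
    by (simp_all add: X_def Y_def nodes_nth)
  \<comment> \<open>Both vectors share the ends \<open>a\<close> and \<open>b\<close>, where the
    difference is 0. A positive maximum is thus attained only at free nodes, where the balance
    equation holds.\<close>
  have "m \<noteq> 0"
  proof
    assume "m = 0"
    with m(2) ends \<open>\<delta> > 0\<close> show False by simp
  qed
  have "m \<noteq> ?n + 1"
  proof
    assume "m = ?n + 1"
    with m(2) ends \<open>\<delta> > 0\<close> show False by simp
  qed
  have mm: "0 < m" "m < ?n + 1" using m \<open>m \<noteq> 0\<close> \<open>m \<noteq> ?n + 1\<close> by auto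
  have sx: "sorted_wrt (<) X" and sy: "sorted_wrt (<) Y"
    using x y ab by (auto simp: X_def Y_def critical_point_def intro!: strict_sorted_nodes)
  have len: "length X = ?n + 2" "length Y = ?n + 2" by (simp_all add: X_def Y_def length_nodes)
  have mono: "X ! i < X ! j" "Y ! i < Y ! j" if "i < j" "j < ?n + 2" for i j
    using that sorted_wrt_nth_less[OF sx, of i j] sorted_wrt_nth_less[OF sy, of i j] len by auto
  have "?d (Suc m) \<noteq> \<delta>"
  proof
    assume "?d (Suc m) = \<delta>"
    then have "Suc m \<in> ?J" using mm by simp
    then have "Suc m \<le> m" using Max_ge[OF J(1), folded m_def] by blast
    then show False by simp
  qed
  then have "?d (Suc m) < \<delta>" using d_le[of "Suc m"] mm by auto
  moreover have "?d (m - 1) \<le> \<delta>" using d_le[of "m - 1"] mm by auto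
  moreover have Ym: "Y ! m = X ! m + \<delta>" using m(2) by simp
  moreover have "a \<le> X ! (m - 1)"
    using less_imp_le[OF mono(1)[of 0 "m - 1"]] mm ends by (cases "m - 1 = 0") auto
  moreover have "Y ! Suc m \<le> b"
    using less_imp_le[OF mono(2)[of "Suc m" "?n + 1"]] mm ends by (cases "Suc m = ?n + 1") auto
  moreover have "X ! (m - 1) < X ! m" "X ! m < X ! Suc m" "Y ! m < Y ! Suc m"
    using mm by (auto intro!: mono)
  ultimately show False
    using balance_comparison[of "X ! (m - 1)" "X ! m" "X ! Suc m" \<delta> "Y ! Suc m" "Y ! (m - 1)"] \<open>\<delta> > 0\<close>
      critical_point_balance[OF x mm] critical_point_balance[OF y mm]
    unfolding X_def[symmetric] Y_def[symmetric] by auto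
qed

lemma critical_point_unique:
  fixes x y :: "real ^ 'n::{finite,linorder}"
  assumes "critical_point r \<mu> a b x" "critical_point r \<mu> a b y"
  shows "x = y"
proof -
  have "nodes a b x = nodes a b y"
    using critical_point_le[OF assms] critical_point_le[OF assms(2,1)]
    by (intro nth_equalityI) (auto simp: length_nodes intro: antisym)
  then show ?thesis by (auto simp: nodes_def vec_eq_iff)
qed

end

theorem corollary2p2:
  fixes N :: nat and r a b :: real and \<mu> :: "real measure"
  assumes "N \<ge> 3" and "CARD('n::{finite,linorder}) = N - 2"
    and "r \<ge> 1"
    and "prob_space \<mu>" and "sets \<mu> = sets borel"
    and atomless: "\<And>x. emeasure \<mu> {x} = 0"
    and "a < b" and "convex hull (measure_support \<mu>) = {a..b}"
  shows "(\<forall>\<Gamma>. optimal_dual_grid r \<mu> N \<Gamma> \<longrightarrow>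
            (\<exists>x :: real ^ 'n::{finite,linorder}. critical_point r \<mu> a b x \<and> \<Gamma> = set (nodes a b x))) \<and>
         (\<forall>f :: real \<Rightarrow> real.
            f \<in> borel_measurable borel \<longrightarrow>
            \<mu> = density lborel (\<lambda>\<xi>. ennreal (f \<xi>)) \<longrightarrow>
            (\<forall>\<xi>\<in>{a<..<b}. f \<xi> > 0) \<longrightarrow>
            (\<forall>\<xi>. \<xi> \<notin> {a<..<b} \<longrightarrow> f \<xi> = 0) \<longrightarrow>
            concave_on {a<..<b} (\<lambda>\<xi>. ln (f \<xi>)) \<longrightarrow>
            (\<exists>xstar :: real ^ 'n::{finite,linorder}.
               {x. critical_point r \<mu> a b x} = {xstar} \<and>
               {\<Gamma>. optimal_dual_grid r \<mu> N \<Gamma>} = {set (nodes a b xstar)}))"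
proof -
  interpret interval_law \<mu> r a b
    using assms by (auto intro!: interval_law.intro interval_law_axioms.intro)
  have N: "N = CARD('n) + 2" using assms by simp
  have opt: "\<exists>x :: (real, 'n) vec. critical_point r \<mu> a b x \<and> \<Gamma> = set (nodes a b x)"
    if "optimal_dual_grid r \<mu> N \<Gamma>" for \<Gamma>
    using optimal_grid_critical[OF that N] by blast
  moreover have "\<exists>xstar :: (real, 'n) vec. {x. critical_point r \<mu> a b x} = {xstar} \<and>
               {\<Gamma>. optimal_dual_grid r \<mu> N \<Gamma>} = {set (nodes a b xstar)}"
    if "f \<in> borel_measurable borel" "\<mu> = density lborel (\<lambda>\<xi>. ennreal (f \<xi>))"
      "\<forall>\<xi>\<in>{a<..<b}. f \<xi> > 0" "\<forall>\<xi>. \<xi> \<notin> {a<..<b} \<longrightarrow> f \<xi> = 0"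
      "concave_on {a<..<b} (\<lambda>\<xi>. ln (f \<xi>))" for f
  proof -
    interpret log_concave_law \<mu> r a b f
      by unfold_locales (use that in auto)
    \<comment> \<open>Existence of an optimal grid supplies the critical point. Every other optimal
      grid also comes from a critical point, so uniqueness of the latter settles both set
      equalities.\<close>
    obtain \<Gamma> where \<Gamma>: "optimal_dual_grid r \<mu> N \<Gamma>" using optimal_grid_exists[OF N] .
    obtain xstar :: "(real, 'n) vec" where xstar: "critical_point r \<mu> a b xstar" "\<Gamma> = set (nodes a b xstar)"
      using opt[OF \<Gamma>] by blast
    have "{x. critical_point r \<mu> a b x} = {xstar}"
      using critical_point_unique xstar by blast
    moreover have "{\<Gamma>. optimal_dual_grid r \<mu> N \<Gamma>} = {set (nodes a b xstar)}"
      using opt critical_point_unique xstar \<Gamma> by blast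
    ultimately show ?thesis by blast
  qed
  ultimately show ?thesis by blast
qed

end
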